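(* Let $\Gamma$ be a finitely generated discrete group, $A\trianglelefteq\Gamma$ normal of finite index, $Q=\Gamma/A$, and $\psi\colon Q\to PU(n)$ a homomorphism. The finite group $\mathrm{Hom}(Q,S^1)$ acts freely on $\mathrm{Hom}_A(\Gamma,U(n))_\psi$ by $(\chi\cdot\rho)(\gamma)=\chi([\gamma])\rho(\gamma)$, and the restriction map $R\colon\mathrm{Hom}_A(\Gamma,U(n))_\psi\to\mathrm{Hom}(A,S^1)$, $\rho\mapsto\rho|_A$, induces a homeomorphism from the orbit space $\mathrm{Hom}_A(\Gamma,U(n))_\psi/\mathrm{Hom}(Q,S^1)$ onto the image $R(\mathrm{Hom}_A(\Gamma,U(n))_\psi)$. In particular $R$ is a finite covering map onto its image with structure group $\mathrm{Hom}(Q,S^1)$.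
   Context: $S^1\subset U(n)$ denotes the scalar matrices (identified with the unit circle), $PU(n)=U(n)/S^1$. $\mathrm{Hom}_A(\Gamma,U(n))$ is the set of $\rho\in\mathrm{Hom}(\Gamma,U(n))$ with $\rho(A)\subset S^1$ (so $\rho|_A\in\mathrm{Hom}(A,S^1)$), and $\mathrm{Hom}_A(\Gamma,U(n))_\psi$ is the subset with induced homomorphism $\bar\rho\colon Q\to PU(n)$ equal to $\psi$. All representation spaces carry the topology of pointwise convergence. *)

theory Defs
  imports "HOL-Analysis.Analysis" "HOL-Algebra.Group_Action" "HOL-Algebra.Generated_Groups"
begin

(* conjugate transpose of a complex square matrix *)
definition adj_mat :: "complex^'n^'n \<Rightarrow> complex^'n^'n" where
  "adj_mat M = (\<chi> i j. cnj (M $ j $ i))"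

(* the unitary group U(n), n = CARD('n) *)
definition unitary_group :: "(complex^'n^'n) monoid" where
  "unitary_group = \<lparr> carrier = {M. M ** adj_mat M = mat 1 \<and> adj_mat M ** M = mat 1},
                     mult = (**), one = mat 1 \<rparr>"

(* S^1 as the scalar matrices in U(n) *)
definition scalar_circle :: "(complex^'n^'n) set" where
  "scalar_circle = {mat c | c. cmod c = 1}"

definition circle_group :: "(complex^'n^'n) monoid" where
  "circle_group = unitary_group\<lparr>carrier := scalar_circle\<rparr>"

(* PU(n) = U(n)/S^1 *)
definition proj_unitary_group :: "(complex^'n^'n) set monoid" where
  "proj_unitary_group = unitary_group Mod scalar_circle"

(* Hom(Gamma,U(n)) as (extensional) functions on the carrier *)
definition Hom_rep :: "('g,'b) monoid_scheme \<Rightarrow> ('g \<Rightarrow> complex^'n^'n) set" where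
  "Hom_rep G = hom G unitary_group \<inter> extensional (carrier G)"

(* Hom_A(Gamma,U(n)) *)
definition Hom_A :: "('g,'b) monoid_scheme \<Rightarrow> 'g set \<Rightarrow> ('g \<Rightarrow> complex^'n^'n) set" where
  "Hom_A G A = {\<rho> \<in> Hom_rep G. \<rho> ` A \<subseteq> scalar_circle}"

(* Hom_A(Gamma,U(n))_psi: the induced map Q -> PU(n), [g] |-> S^1 #> rho g, equals psi *)
definition Hom_A_psi :: "('g,'b) monoid_scheme \<Rightarrow> 'g set \<Rightarrow> ('g set \<Rightarrow> (complex^'n^'n) set)
     \<Rightarrow> ('g \<Rightarrow> complex^'n^'n) set" where
  "Hom_A_psi G A \<psi> = {\<rho> \<in> Hom_A G A.
      \<forall>g \<in> carrier G. \<psi> (A #>\<^bsub>G\<^esub> g) = scalar_circle #>\<^bsub>unitary_group\<^esub> \<rho> g}"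

(* Hom(A,S^1) *)
definition Hom_circle :: "('g,'b) monoid_scheme \<Rightarrow> 'g set \<Rightarrow> ('g \<Rightarrow> complex^'n^'n) set" where
  "Hom_circle G A = hom (G\<lparr>carrier := A\<rparr>) circle_group \<inter> extensional A"

(* the character group Hom(Q,S^1), Q = G Mod A, with pointwise multiplication *)
definition char_group :: "('g,'b) monoid_scheme \<Rightarrow> 'g set \<Rightarrow> ('g set \<Rightarrow> complex^'n^'n) monoid" where
  "char_group G A = \<lparr> carrier = hom (G Mod A) circle_group \<inter> extensional (carrier (G Mod A)),
       mult = (\<lambda>c1 c2. \<lambda>q \<in> carrier (G Mod A). c1 q ** c2 q),
       one = (\<lambda>q \<in> carrier (G Mod A). mat 1) \<rparr>"

(* the action (chi . rho)(g) = chi([g]) rho(g) *)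
definition char_action :: "('g,'b) monoid_scheme \<Rightarrow> 'g set \<Rightarrow> ('g \<Rightarrow> complex^'n^'n) set
     \<Rightarrow> ('g set \<Rightarrow> complex^'n^'n) \<Rightarrow> ('g \<Rightarrow> complex^'n^'n) \<Rightarrow> ('g \<Rightarrow> complex^'n^'n)" where
  "char_action G A E c = (\<lambda>\<rho> \<in> E. \<lambda>g \<in> carrier G. c (A #>\<^bsub>G\<^esub> g) ** \<rho> g)"

(* topology of pointwise convergence on functions I -> 'a *)
definition pointwise_top :: "'i set \<Rightarrow> ('i \<Rightarrow> 'a::topological_space) topology" where
  "pointwise_top I = product_topology (\<lambda>_. euclidean) I"

(* quotient topology on a set P of subsets (e.g. a partition of topspace X) *)
definition partition_quotient_top :: "'a topology \<Rightarrow> 'a set set \<Rightarrow> 'a set topology" where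
  "partition_quotient_top X P = topology (\<lambda>U. U \<subseteq> P \<and> openin X (\<Union>U))"

(* covering maps for abstract topological spaces (mirrors covering_space) *)
definition covering_map :: "'a topology \<Rightarrow> 'b topology \<Rightarrow> ('a \<Rightarrow> 'b) \<Rightarrow> bool" where
  "covering_map X Y p \<longleftrightarrow>
     continuous_map X Y p \<and> p ` topspace X = topspace Y \<and>
     (\<forall>y \<in> topspace Y. \<exists>T. y \<in> T \<and> openin Y T \<and>
        (\<exists>v. \<Union>v = {x \<in> topspace X. p x \<in> T} \<and>
             (\<forall>u \<in> v. openin X u) \<and> pairwise disjnt v \<and>
             (\<forall>u \<in> v. homeomorphic_map (subtopology X u) (subtopology Y T) p)))"

end

theory Submission
  imports Defs "HOL-Algebra.Multiplicative_Group"
begin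

(* Lifts of a projective representation and their restrictions to A.

   Let A be a normal subgroup of finite index in G, Q = G/A, and psi : Q -> PU(n).  The lifts
   E = Hom_A(G, U(n))_psi form a compact space (a closed subset of the product of the compact
   cosets psi(gA) in U(n)), on which the finite character group Hom(Q, S^1) acts freely and
   continuously by (chi . rho)(g) = chi(gA) rho(g).  Two lifts have the same restriction to A
   exactly when they differ by a character, i.e. the fibres of the restriction map R are the
   orbits.  Since R is a continuous map from a compact space to a Hausdorff space, it is closed.

   It then sets up the
   matrix groups U(n) and S^1, the character group, and the lifts (locale projective_lifts),
   verifies the hypotheses of orbit_projection for R, and reads off the theorem. *)

lemma openin_Collect_finite_ball:
  assumes "finite I" and "\<And>i. i \<in> I \<Longrightarrow> openin X {x \<in> topspace X. P i x}"
  shows "openin X {x \<in> topspace X. \<forall>i\<in>I. P i x}"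
proof -
  have "{x \<in> topspace X. \<forall>i\<in>I. P i x} = (\<Inter>i\<in>I. {x \<in> topspace X. P i x}) \<inter> topspace X"
    by blast
  then show ?thesis using openin_INT[OF assms] by (simp only:)
qed

lemma closedin_Collect_ball:
  assumes "\<And>i. i \<in> I \<Longrightarrow> closedin X {x \<in> topspace X. P i x}"
  shows "closedin X {x \<in> topspace X. \<forall>i\<in>I. P i x}"
proof (cases "I = {}")
  case False
  have "{x \<in> topspace X. \<forall>i\<in>I. P i x} = (\<Inter>i\<in>I. {x \<in> topspace X. P i x})"
    using False by blast
  then show ?thesis using closedin_INT[OF False assms] by (simp only:)
next
  case True
  then show ?thesis by simp
qed

lemma openin_partition_quotient_top:
  assumes "pairwise disjnt P"
  shows "openin (partition_quotient_top X P) U \<longleftrightarrow> U \<subseteq> P \<and> openin X (\<Union>U)"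
proof -
  have "istopology (\<lambda>U. U \<subseteq> P \<and> openin X (\<Union>U))"
    unfolding istopology_def
  proof (rule conjI; intro allI impI)
    fix S T assume S: "S \<subseteq> P \<and> openin X (\<Union>S)" and T: "T \<subseteq> P \<and> openin X (\<Union>T)"
    have "B = C" if "B \<in> S" "C \<in> T" "x \<in> B" "x \<in> C" for B C x
      using that S T assms unfolding pairwise_def disjnt_def by blast
    then have "\<Union>(S \<inter> T) = \<Union>S \<inter> \<Union>T" by blast
    then show "S \<inter> T \<subseteq> P \<and> openin X (\<Union>(S \<inter> T))" using S T by (auto simp: openin_Int)
  next
    fix K assume K: "\<forall>U\<in>K. U \<subseteq> P \<and> openin X (\<Union>U)"
    have "\<Union>(\<Union>K) = \<Union>(Union ` K)" by blast
    moreover have "openin X (\<Union>(Union ` K))"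
    proof (rule openin_Union)
      fix S assume "S \<in> Union ` K"
      then show "openin X S" using K by blast
    qed
    ultimately show "\<Union>K \<subseteq> P \<and> openin X (\<Union>(\<Union>K))" using K by auto
  qed
  then show ?thesis by (simp add: partition_quotient_top_def)
qed

lemma topspace_partition_quotient_top:
  assumes "pairwise disjnt P" and "\<Union>P = topspace X"
  shows "topspace (partition_quotient_top X P) = P"
proof
  have "openin (partition_quotient_top X P) P"
    unfolding openin_partition_quotient_top[OF assms(1)] assms(2) by simp
  then show "P \<subseteq> topspace (partition_quotient_top X P)"
    by (rule openin_subset)
  show "topspace (partition_quotient_top X P) \<subseteq> P"
  proof
    fix B assume "B \<in> topspace (partition_quotient_top X P)"
    then obtain U where "openin (partition_quotient_top X P) U" "B \<in> U"
      unfolding topspace_def by blast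
    then show "B \<in> P" unfolding openin_partition_quotient_top[OF assms(1)] by blast
  qed
qed

text \<open>The fibres of a map \<open>p\<close> partition the space; \<open>fibre_value p B\<close> is the common value of \<open>p\<close>
  on a block \<open>B\<close>.\<close>

definition fibre_partition :: "'a topology \<Rightarrow> ('a \<Rightarrow> 'b) \<Rightarrow> 'a set set" where
  "fibre_partition X p = (\<lambda>x. {y \<in> topspace X. p y = p x}) ` topspace X"

definition fibre_value :: "('a \<Rightarrow> 'b) \<Rightarrow> 'a set \<Rightarrow> 'b" where
  "fibre_value p B = p (SOME x. x \<in> B)"

lemma fibre_partition_block:
  assumes "B \<in> fibre_partition X p" and "x \<in> B"
  shows "B = {y \<in> topspace X. p y = p x}"
proof -
  obtain x0 where B: "B = {y \<in> topspace X. p y = p x0}"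
    using assms(1) unfolding fibre_partition_def by blast
  then have "p x = p x0" using assms(2) by simp
  then show ?thesis using B by simp
qed

lemma fibre_partition_nonempty: "B \<in> fibre_partition X p \<Longrightarrow> \<exists>x. x \<in> B"
  unfolding fibre_partition_def by blast

lemma fibre_partition_disjnt: "pairwise disjnt (fibre_partition X p)"
  unfolding pairwise_def disjnt_def
proof (intro ballI impI)
  fix B C assume B: "B \<in> fibre_partition X p" and C: "C \<in> fibre_partition X p" and "B \<noteq> C"
  moreover have "B = C" if "x \<in> B" "x \<in> C" for x
    using fibre_partition_block[OF B that(1)] fibre_partition_block[OF C that(2)] by simp
  ultimately show "B \<inter> C = {}" by blast
qed

lemma Union_fibre_partition: "\<Union>(fibre_partition X p) = topspace X"
proof (intro equalityI subsetI)
  fix x assume "x \<in> \<Union>(fibre_partition X p)"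
  then show "x \<in> topspace X" unfolding fibre_partition_def by blast
next
  fix x assume x: "x \<in> topspace X"
  then have "{y \<in> topspace X. p y = p x} \<in> fibre_partition X p"
    unfolding fibre_partition_def by blast
  then show "x \<in> \<Union>(fibre_partition X p)" using x by blast
qed

lemma fibre_value_block:
  assumes "B \<in> fibre_partition X p" and "x \<in> B"
  shows "fibre_value p B = p x"
proof -
  have "(SOME x. x \<in> B) \<in> B" using someI assms(2) .
  then show ?thesis
    using fibre_partition_block[OF assms] assms(2) by (simp add: fibre_value_def)
qed

text \<open>Images of unions of blocks, and complements of unions of blocks.\<close>

lemma fibre_value_image:
  assumes C: "C \<subseteq> fibre_partition X p"
  shows "fibre_value p ` C = p ` \<Union>C"
proof (intro equalityI subsetI)
  fix y assume "y \<in> fibre_value p ` C"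
  then obtain B where B: "B \<in> C" and y: "y = fibre_value p B" by blast
  obtain x where x: "x \<in> B" using fibre_partition_nonempty B C by blast
  have "y = p x" using fibre_value_block[of B X p x] B C x y by (simp add: subset_iff)
  then show "y \<in> p ` \<Union>C" using B x by blast
next
  fix y assume "y \<in> p ` \<Union>C"
  then obtain B x where B: "B \<in> C" and x: "x \<in> B" and y: "y = p x" by blast
  have "y = fibre_value p B" using fibre_value_block[of B X p x] B C x y by (simp add: subset_iff)
  then show "y \<in> fibre_value p ` C" using B by blast
qed

lemma Union_fibre_partition_complement:
  assumes C: "C \<subseteq> fibre_partition X p"
  shows "\<Union>C = topspace X - \<Union>(fibre_partition X p - C)"
proof (intro equalityI subsetI)
  fix x assume "x \<in> \<Union>C"
  then obtain B where B: "B \<in> C" and x: "x \<in> B" by blast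
  have "x \<notin> B'" if B': "B' \<in> fibre_partition X p - C" for B'
  proof
    assume "x \<in> B'"
    then have "B' = B"
      using fibre_partition_block[of B' X p x] fibre_partition_block[of B X p x] B' B C x
      by (simp add: subset_iff)
    then show False using B B' by blast
  qed
  then show "x \<in> topspace X - \<Union>(fibre_partition X p - C)"
    using B C x Union_fibre_partition[of X p] by blast
next
  fix x assume "x \<in> topspace X - \<Union>(fibre_partition X p - C)"
  then show "x \<in> \<Union>C" using Union_fibre_partition[of X p] by blast
qed

lemma fibre_value_preimage:
  "\<Union>{B \<in> fibre_partition X p. fibre_value p B \<in> V} = {x \<in> topspace X. p x \<in> V}"
proof (intro equalityI subsetI)
  fix x assume "x \<in> \<Union>{B \<in> fibre_partition X p. fibre_value p B \<in> V}"
  then obtain B where B: "B \<in> fibre_partition X p" "fibre_value p B \<in> V" "x \<in> B" by blast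
  then have "x \<in> topspace X" using Union_fibre_partition[of X p] by blast
  then show "x \<in> {x \<in> topspace X. p x \<in> V}" using fibre_value_block[of B X p x] B by simp
next
  fix x assume x: "x \<in> {x \<in> topspace X. p x \<in> V}"
  let ?B = "{y \<in> topspace X. p y = p x}"
  have B: "?B \<in> fibre_partition X p" "x \<in> ?B"
    using x unfolding fibre_partition_def by (blast, simp)
  then have "fibre_value p ?B \<in> V" using x fibre_value_block[OF B] by simp
  then show "x \<in> \<Union>{B \<in> fibre_partition X p. fibre_value p B \<in> V}" using B by blast
qed

text \<open>A continuous closed surjection \<open>p : X \<rightarrow> Y\<close> identifies \<open>Y\<close> with the space of fibres of \<open>p\<close>
  carrying the quotient topology.\<close>

theorem fibre_partition_quotient_homeomorphic:
  assumes cont: "continuous_map X Y p" and closed: "closed_map X Y p"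
    and surj: "p ` topspace X = topspace Y"
  shows "homeomorphic_map (partition_quotient_top X (fibre_partition X p)) Y (fibre_value p)"
proof (rule bijective_closed_imp_homeomorphic_map)
  let ?F = "fibre_partition X p"
  let ?Q = "partition_quotient_top X ?F"
  have top_Q: "topspace ?Q = ?F"
    by (rule topspace_partition_quotient_top[OF fibre_partition_disjnt[of X p] Union_fibre_partition])
  have open_Q: "openin ?Q U \<longleftrightarrow> U \<subseteq> ?F \<and> openin X (\<Union>U)" for U
    by (rule openin_partition_quotient_top[OF fibre_partition_disjnt[of X p]])
  show surj_f: "fibre_value p ` topspace ?Q = topspace Y"
    using fibre_value_image[of ?F X p] surj by (simp add: top_Q Union_fibre_partition)
  show "continuous_map ?Q Y (fibre_value p)"
    unfolding continuous_map_def
  proof (intro conjI allI impI)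
    show "fibre_value p \<in> topspace ?Q \<rightarrow> topspace Y" using surj_f by blast
    fix V assume "openin Y V"
    then have "openin X {x \<in> topspace X. p x \<in> V}"
      by (rule openin_continuous_map_preimage[OF cont])
    then show "openin ?Q {B \<in> topspace ?Q. fibre_value p B \<in> V}"
      by (simp add: open_Q top_Q fibre_value_preimage)
  qed
  show "closed_map ?Q Y (fibre_value p)"
    unfolding closed_map_def
  proof (intro allI impI)
    fix C assume "closedin ?Q C"
    then have C: "C \<subseteq> ?F" and open_diff: "openin ?Q (?F - C)"
      by (simp_all add: closedin_def top_Q)
    have "openin X (\<Union>(?F - C))"
      using open_diff unfolding open_Q by (rule conjunct2)
    with Union_fibre_partition_complement[OF C] have "closedin X (\<Union>C)"
      by (simp add: closedin_diff)
    then show "closedin Y (fibre_value p ` C)"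
      using closed C by (simp add: closed_map_def fibre_value_image)
  qed
  show "inj_on (fibre_value p) (topspace ?Q)"
  proof (rule inj_onI)
    fix B1 B2 assume B1: "B1 \<in> topspace ?Q" and B2: "B2 \<in> topspace ?Q"
      and eq: "fibre_value p B1 = fibre_value p B2"
    obtain x1 x2 where x: "x1 \<in> B1" "x2 \<in> B2"
      using fibre_partition_nonempty[of B1 X p] fibre_partition_nonempty[of B2 X p] B1 B2
      by (auto simp: top_Q)
    then have "p x1 = p x2"
      using fibre_value_block[of B1 X p x1] fibre_value_block[of B2 X p x2] B1 B2 eq
      by (simp add: top_Q)
    then show "B1 = B2"
      using fibre_partition_block[of B1 X p x1] fibre_partition_block[of B2 X p x2] B1 B2 x
      by (simp add: top_Q)
  qed
qed

text \<open>A set \<open>U\<close> is wandering for an action \<open>\<phi>\<close> of \<open>G\<close> if no element other than \<open>1\<close> maps a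
  point of \<open>U\<close> back into \<open>U\<close>.\<close>

definition wandering_set :: "('g, 'm) monoid_scheme \<Rightarrow> ('g \<Rightarrow> 'a \<Rightarrow> 'a) \<Rightarrow> 'a set \<Rightarrow> bool" where
  "wandering_set G \<phi> U \<longleftrightarrow> (\<forall>g\<in>carrier G. \<forall>u\<in>U. \<phi> g u \<in> U \<longrightarrow> g = \<one>\<^bsub>G\<^esub>)"

text \<open>Orbit projections. The locale describes a group acting by continuous maps on a space
  \<open>X\<close> together with a continuous, closed surjection \<open>p\<close> onto \<open>Y\<close> whose fibres are exactly
  the orbits.\<close>

locale orbit_projection = group_action G "topspace X" \<phi>
  for G (structure) and X :: "'a topology" and \<phi> +
  fixes Y :: "'b topology" and p :: "'a \<Rightarrow> 'b"
  assumes action_continuous: "g \<in> carrier G \<Longrightarrow> continuous_map X X (\<phi> g)"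
    and projection_continuous: "continuous_map X Y p"
    and projection_closed: "closed_map X Y p"
    and projection_surjective: "p ` topspace X = topspace Y"
    and fibre_eq_orbit: "x \<in> topspace X \<Longrightarrow> {y \<in> topspace X. p y = p x} = orbit G \<phi> x"
begin

lemma group: "group G"
  by (rule group_hom.axioms(1)[OF group_hom])

lemma projection_invariant:
  assumes "g \<in> carrier G" and "x \<in> topspace X"
  shows "p (\<phi> g x) = p x"
proof -
  have "\<phi> g x \<in> orbit G \<phi> x" using assms(1) unfolding orbit_def by blast
  then show ?thesis using fibre_eq_orbit[OF assms(2)] by blast
qed

lemma same_fibre_imp_orbit:
  assumes "x \<in> topspace X" and "y \<in> topspace X" and "p y = p x"
  obtains g where "g \<in> carrier G" and "y = \<phi> g x"
proof -
  have "y \<in> orbit G \<phi> x" using fibre_eq_orbit[OF assms(1)] assms(2,3) by blast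
  then show ?thesis using that unfolding orbit_def by blast
qed

lemma action_one: "x \<in> topspace X \<Longrightarrow> \<phi> \<one> x = x"
  by (metis id_eq_one restrict_apply')

text \<open>Each group element acts by a homeomorphism, with inverse given by the inverse element.\<close>
lemma action_homeomorphic: "g \<in> carrier G \<Longrightarrow> homeomorphic_map X X (\<phi> g)"
  unfolding homeomorphic_map_maps homeomorphic_maps_def
proof (intro exI conjI ballI)
  assume g: "g \<in> carrier G"
  have g': "inv g \<in> carrier G" using group.inv_closed[OF group g] .
  show "continuous_map X X (\<phi> g)" "continuous_map X X (\<phi> (inv g))"
    using g g' by (simp_all add: action_continuous)
  show "\<phi> (inv g) (\<phi> g x) = x" if "x \<in> topspace X" for x
    using orbit_sym_aux[OF g that] by simp
  show "\<phi> g (\<phi> (inv g) x) = x" if "x \<in> topspace X" for x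
    using orbit_sym_aux[OF g' that] group.inv_inv[OF group g] by simp
qed

text \<open>The projection is open: the saturation \<open>p\<^sup>-\<^sup>1(p W)\<close> of an open set \<open>W\<close> is the union of
  its translates, hence open, so \<open>p W\<close> is the complement of the image of a closed set.\<close>
lemma projection_open: "open_map X Y p"
  unfolding open_map_def
proof (intro allI impI)
  fix W assume W: "openin X W"
  have WX: "W \<subseteq> topspace X" using openin_subset[OF W] .
  define S where "S = {x \<in> topspace X. p x \<in> p ` W}"
  have "S = (\<Union>g\<in>carrier G. {x \<in> topspace X. \<phi> g x \<in> W})"
  proof (intro equalityI subsetI)
    fix x assume "x \<in> S"
    then obtain w where x: "x \<in> topspace X" and w: "w \<in> W" "p x = p w"
      unfolding S_def by blast
    moreover have "w \<in> topspace X" using w WX by blast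
    ultimately obtain g where "g \<in> carrier G" "w = \<phi> g x"
      using same_fibre_imp_orbit[of x w] by metis
    then show "x \<in> (\<Union>g\<in>carrier G. {x \<in> topspace X. \<phi> g x \<in> W})" using x w by blast
  next
    fix x assume "x \<in> (\<Union>g\<in>carrier G. {x \<in> topspace X. \<phi> g x \<in> W})"
    then obtain g where g: "g \<in> carrier G" and x: "x \<in> topspace X" "\<phi> g x \<in> W" by blast
    then have "p x = p (\<phi> g x)" by (simp add: projection_invariant)
    then show "x \<in> S" using x unfolding S_def by blast
  qed
  moreover have "openin X (\<Union>g\<in>carrier G. {x \<in> topspace X. \<phi> g x \<in> W})"
    by (intro openin_Union) (auto intro: openin_continuous_map_preimage[OF action_continuous W])
  ultimately have "openin X S" by simp
  then have "closedin Y (p ` (topspace X - S))"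
    using projection_closed by (simp add: closed_map_def closedin_diff)
  moreover have "p ` W = topspace Y - p ` (topspace X - S)"
  proof (intro equalityI subsetI)
    fix y assume y: "y \<in> p ` W"
    then have "y \<in> topspace Y" using projection_surjective WX by blast
    moreover have "y \<notin> p ` (topspace X - S)" using y unfolding S_def by blast
    ultimately show "y \<in> topspace Y - p ` (topspace X - S)" by blast
  next
    fix y assume y: "y \<in> topspace Y - p ` (topspace X - S)"
    then obtain x where "x \<in> topspace X" "y = p x" using projection_surjective by blast
    then show "y \<in> p ` W" using y unfolding S_def by blast
  qed
  ultimately show "openin Y (p ` W)" by (simp add: openin_diff)
qed

lemma orbits_eq_fibre_partition: "orbits G (topspace X) \<phi> = fibre_partition X p"
proof -
  have "orbits G (topspace X) \<phi> = orbit G \<phi> ` topspace X"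
    unfolding orbits_def by blast
  also have "\<dots> = fibre_partition X p"
    unfolding fibre_partition_def by (rule image_cong[OF refl]) (simp add: fibre_eq_orbit)
  finally show ?thesis .
qed

text \<open>The orbit space, with the quotient topology, is homeomorphic to \<open>Y\<close>; the homeomorphism
  sends the orbit of \<open>x\<close> to \<open>p x\<close>.\<close>

theorem orbit_space_homeomorphic:
  "homeomorphic_map (partition_quotient_top X (orbits G (topspace X) \<phi>)) Y (fibre_value p)"
  unfolding orbits_eq_fibre_partition
  by (rule fibre_partition_quotient_homeomorphic[OF projection_continuous projection_closed
        projection_surjective])

lemma fibre_value_orbit:
  assumes x: "x \<in> topspace X"
  shows "fibre_value p (orbit G \<phi> x) = p x"
proof -
  have "orbit G \<phi> x \<in> fibre_partition X p"
    using x unfolding orbits_eq_fibre_partition[symmetric] orbits_def by blast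
  then show ?thesis by (rule fibre_value_block[OF _ orbit_refl[OF x]])
qed

text \<open>For a free action of a finite group on a Hausdorff space every point has a
  wandering neighbourhood: separate \<open>x\<close> from each of its finitely many translates \<open>g x\<close>,
  \<open>g \<noteq> 1\<close>, and intersect the resulting open sets.\<close>

lemma wandering_neighbourhood:
  assumes finite: "finite (carrier G)" and Hausdorff: "Hausdorff_space X"
    and free: "\<forall>g\<in>carrier G. \<forall>y\<in>topspace X. \<phi> g y = y \<longrightarrow> g = \<one>"
    and x: "x \<in> topspace X"
  shows "\<exists>U. openin X U \<and> x \<in> U \<and> wandering_set G \<phi> U"
proof -
  define C where "C = carrier G - {\<one>}"
  have "\<exists>V W. openin X V \<and> openin X W \<and> x \<in> V \<and> \<phi> g x \<in> W \<and> disjnt V W"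
    if g: "g \<in> C" for g
  proof -
    have "\<phi> g x \<noteq> x" using free g x by (auto simp: C_def)
    moreover have "\<phi> g x \<in> topspace X"
      using g x element_image[of g x "\<phi> g x"] by (simp add: C_def)
    ultimately show ?thesis using Hausdorff x unfolding Hausdorff_space_def by metis
  qed
  then obtain V W where VW: "\<And>g. g \<in> C \<Longrightarrow>
      openin X (V g) \<and> openin X (W g) \<and> x \<in> V g \<and> \<phi> g x \<in> W g \<and> disjnt (V g) (W g)"
    by metis
  define U where "U = {y \<in> topspace X. \<forall>g\<in>C. y \<in> V g \<and> \<phi> g y \<in> W g}"
  have "openin X U"
    unfolding U_def
  proof (rule openin_Collect_finite_ball)
    show "finite C" using finite by (simp add: C_def)
    fix g assume g: "g \<in> C"
    have "{y \<in> topspace X. y \<in> V g \<and> \<phi> g y \<in> W g} = V g \<inter> {y \<in> topspace X. \<phi> g y \<in> W g}"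
      using openin_subset VW[OF g] by blast
    moreover have "openin X {y \<in> topspace X. \<phi> g y \<in> W g}"
    proof (rule openin_continuous_map_preimage)
      show "continuous_map X X (\<phi> g)" using g action_continuous by (simp add: C_def)
      show "openin X (W g)" using VW[OF g] by blast
    qed
    ultimately show "openin X {y \<in> topspace X. y \<in> V g \<and> \<phi> g y \<in> W g}"
      using VW[OF g] by (simp add: openin_Int)
  qed
  moreover have "x \<in> U" using x VW by (simp add: U_def)
  moreover have "wandering_set G \<phi> U"
    unfolding wandering_set_def
  proof (intro ballI impI)
    fix g u assume g: "g \<in> carrier G" and u: "u \<in> U" "\<phi> g u \<in> U"
    show "g = \<one>"
    proof (rule ccontr)
      assume "g \<noteq> \<one>"
      then have gC: "g \<in> C" using g by (simp add: C_def)
      then have "\<phi> g u \<in> W g" "\<phi> g u \<in> V g" using u by (auto simp: U_def)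
      then show False using VW[OF gC] by (auto simp: disjnt_def)
    qed
  qed
  ultimately show ?thesis by (intro exI[of _ U] conjI)
qed

text \<open>Distinct translates of a wandering set are disjoint.\<close>

lemma wandering_translates_disjoint:
  assumes UX: "U \<subseteq> topspace X" and wandering: "wandering_set G \<phi> U"
  shows "pairwise disjnt ((\<lambda>g. \<phi> g ` U) ` carrier G)"
  unfolding pairwise_def disjnt_def
proof (intro ballI impI)
  interpret G: group G by (rule group)
  fix s1 s2 assume s: "s1 \<in> (\<lambda>g. \<phi> g ` U) ` carrier G" "s2 \<in> (\<lambda>g. \<phi> g ` U) ` carrier G"
    and ne: "s1 \<noteq> s2"
  then obtain g1 g2 where g1: "g1 \<in> carrier G" and g2: "g2 \<in> carrier G"
    and s12: "s1 = \<phi> g1 ` U" "s2 = \<phi> g2 ` U" by blast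
  show "s1 \<inter> s2 = {}"
  proof (rule ccontr)
    assume "s1 \<inter> s2 \<noteq> {}"
    then obtain u1 u2 where u: "u1 \<in> U" "u2 \<in> U" and eq: "\<phi> g1 u1 = \<phi> g2 u2"
      unfolding s12 by blast
    have h: "inv g1 \<otimes> g2 \<in> carrier G" using g1 g2 by simp
    have uX: "u1 \<in> topspace X" "u2 \<in> topspace X" using u UX by auto
    have "\<phi> (inv g1 \<otimes> g2) u2 = \<phi> (inv g1) (\<phi> g2 u2)"
      by (rule composition_rule[OF uX(2) G.inv_closed[OF g1] g2])
    also have "\<dots> = u1" by (rule orbit_sym_aux[OF g1 uX(1) eq])
    finally have one: "inv g1 \<otimes> g2 = \<one>"
      using wandering h u unfolding wandering_set_def by metis
    have "g2 = g1 \<otimes> (inv g1 \<otimes> g2)" using g1 g2 by (simp add: G.m_assoc[symmetric])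
    also have "\<dots> = g1" using g1 by (simp add: one)
    finally show False using ne s12 by simp
  qed
qed

text \<open>The translates of \<open>U\<close> exactly cover the preimage of \<open>p U\<close>.\<close>

lemma translates_cover_preimage:
  assumes UX: "U \<subseteq> topspace X"
  shows "\<Union>((\<lambda>g. \<phi> g ` U) ` carrier G) = {x \<in> topspace X. p x \<in> p ` U}"
proof (intro equalityI subsetI)
  fix z assume "z \<in> \<Union>((\<lambda>g. \<phi> g ` U) ` carrier G)"
  then obtain g u where g: "g \<in> carrier G" and u: "u \<in> U" and z: "z = \<phi> g u" by blast
  have "z \<in> topspace X" using element_image[of g u z] g u UX z by blast
  moreover have "p z = p u" using projection_invariant g u UX z by blast
  ultimately show "z \<in> {x \<in> topspace X. p x \<in> p ` U}" using u by simp
next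
  fix z assume "z \<in> {x \<in> topspace X. p x \<in> p ` U}"
  then obtain u where z: "z \<in> topspace X" and u: "u \<in> U" "p z = p u" by blast
  then obtain g where "g \<in> carrier G" "z = \<phi> g u"
    using same_fibre_imp_orbit[of u z] UX by blast
  then show "z \<in> \<Union>((\<lambda>g. \<phi> g ` U) ` carrier G)" using u by blast
qed

text \<open>Over the open set \<open>p U\<close>, each translate of an open wandering set \<open>U\<close> is a sheet.\<close>

lemma wandering_sheet_homeomorphic:
  assumes U: "openin X U" and wandering: "wandering_set G \<phi> U" and g: "g \<in> carrier G"
  shows "homeomorphic_map (subtopology X (\<phi> g ` U)) (subtopology Y (p ` U)) p"
proof (rule bijective_open_imp_homeomorphic_map)
  have UX: "U \<subseteq> topspace X" using openin_subset[OF U] .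
  have sheet_open: "openin X (\<phi> g ` U)"
    using homeomorphic_imp_open_map[OF action_homeomorphic[OF g]] U by (simp add: open_map_def)
  have top_sheet: "topspace (subtopology X (\<phi> g ` U)) = \<phi> g ` U"
    using openin_subset[OF sheet_open] by auto
  have top_image: "topspace (subtopology Y (p ` U)) = p ` U"
    using UX projection_surjective by auto
  have image: "p ` \<phi> g ` U = p ` U"
    unfolding image_image using UX g
    by (intro image_cong[OF refl]) (simp add: projection_invariant subset_iff)
  show "continuous_map (subtopology X (\<phi> g ` U)) (subtopology Y (p ` U)) p"
    using image top_sheet
    by (intro continuous_map_into_subtopology continuous_map_from_subtopology projection_continuous)
      auto
  show "open_map (subtopology X (\<phi> g ` U)) (subtopology Y (p ` U)) p"
    using image top_sheet
    by (intro open_map_into_subtopology open_map_from_subtopology projection_open sheet_open) auto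
  show "p ` topspace (subtopology X (\<phi> g ` U)) = topspace (subtopology Y (p ` U))"
    using image top_sheet top_image by simp
  show "inj_on p (topspace (subtopology X (\<phi> g ` U)))"
    unfolding top_sheet
  proof (rule inj_onI)
    fix x1 x2 assume "x1 \<in> \<phi> g ` U" "x2 \<in> \<phi> g ` U" and eq: "p x1 = p x2"
    then obtain u1 u2 where u: "u1 \<in> U" "u2 \<in> U" and x: "x1 = \<phi> g u1" "x2 = \<phi> g u2" by blast
    have uX: "u1 \<in> topspace X" "u2 \<in> topspace X" using u UX by auto
    have "p u1 = p u2" using eq x uX g by (simp add: projection_invariant)
    then obtain h where h: "h \<in> carrier G" and hu: "u1 = \<phi> h u2"
      using same_fibre_imp_orbit[OF uX(2) uX(1)] by blast
    have "h = \<one>" using wandering h u hu unfolding wandering_set_def by metis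
    then have "u1 = u2" using hu action_one[OF uX(2)] by simp
    then show "x1 = x2" using x by simp
  qed
qed

text \<open>Main result on orbit projections: for a free action of a finite group on a Hausdorff
  space the projection is a covering map; the image of a wandering neighbourhood is evenly
  covered by its translates.\<close>

theorem covering_map_of_free_action:
  assumes "finite (carrier G)" and "Hausdorff_space X"
    and "\<forall>g\<in>carrier G. \<forall>y\<in>topspace X. \<phi> g y = y \<longrightarrow> g = \<one>"
  shows "covering_map X Y p"
  unfolding covering_map_def
proof (intro conjI ballI)
  show "continuous_map X Y p" by (rule projection_continuous)
  show "p ` topspace X = topspace Y" by (rule projection_surjective)
  fix y assume "y \<in> topspace Y"
  then have "y \<in> p ` topspace X" by (simp add: projection_surjective)
  then obtain x where x: "x \<in> topspace X" "p x = y" by blast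
  obtain U where U: "openin X U" "x \<in> U" and wandering: "wandering_set G \<phi> U"
    using wandering_neighbourhood[OF assms x(1)] by metis
  have UX: "U \<subseteq> topspace X" using openin_subset[OF U(1)] .
  let ?sheets = "(\<lambda>g. \<phi> g ` U) ` carrier G"
  show "\<exists>T. y \<in> T \<and> openin Y T \<and>
        (\<exists>v. \<Union>v = {x \<in> topspace X. p x \<in> T} \<and> (\<forall>u\<in>v. openin X u) \<and> pairwise disjnt v \<and>
             (\<forall>u\<in>v. homeomorphic_map (subtopology X u) (subtopology Y T) p))"
  proof (intro exI conjI)
    show "y \<in> p ` U" using x U by blast
    show "openin Y (p ` U)" using projection_open U by (simp add: open_map_def)
    show "\<Union>?sheets = {x \<in> topspace X. p x \<in> p ` U}"
      by (rule translates_cover_preimage[OF UX])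
    show "\<forall>s\<in>?sheets. openin X s"
    proof
      fix s assume "s \<in> ?sheets"
      then obtain g where g: "g \<in> carrier G" and s: "s = \<phi> g ` U" by blast
      show "openin X s"
        using homeomorphic_imp_open_map[OF action_homeomorphic[OF g]] U(1)
        unfolding s open_map_def by simp
    qed
    show "pairwise disjnt ?sheets"
      by (rule wandering_translates_disjoint[OF UX wandering])
    show "\<forall>s\<in>?sheets. homeomorphic_map (subtopology X s) (subtopology Y (p ` U)) p"
      using wandering_sheet_homeomorphic[OF U(1) wandering] by blast
  qed
qed

end

text \<open>Scalar matrices, the adjoint, and the unitary group \<open>U(n)\<close>.\<close>

lemma mat_mult_left: "(mat c :: complex^'n^'n) ** M = (\<chi> i j. c * M$i$j)"
  unfolding matrix_matrix_mult_def mat_def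
  by (auto simp: if_distrib if_distribR sum.delta'[OF finite] cong: if_cong)

lemma mat_mult_right: "M ** (mat c :: complex^'n^'n) = (\<chi> i j. M$i$j * c)"
  unfolding matrix_matrix_mult_def mat_def
  by (auto simp: if_distrib if_distribR sum.delta'[OF finite] cong: if_cong)

lemma mat_commute: "(mat c :: complex^'n^'n) ** M = M ** mat c"
  by (simp add: mat_mult_left mat_mult_right mult.commute)

lemma mat_mult_mat: "(mat a :: complex^'n^'n) ** mat b = mat (a * b)"
  by (subst mat_mult_left) (simp add: vec_eq_iff mat_def)

lemma mat_inject:
  assumes "(mat a :: complex^'n^'n) = mat b"
  shows "a = b"
proof -
  have "(mat a :: complex^'n^'n) $ i $ i = mat b $ i $ i" for i using assms by (simp only:)
  from this[of undefined] show ?thesis by (simp add: mat_def)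
qed

lemma adj_mat_mat: "adj_mat (mat c :: complex^'n^'n) = mat (cnj c)"
  by (simp add: adj_mat_def mat_def vec_eq_iff)

lemma adj_mat_adj_mat: "adj_mat (adj_mat M) = (M :: complex^'n^'n)"
  by (simp add: adj_mat_def vec_eq_iff)

lemma adj_mat_mult: "adj_mat (A ** B) = adj_mat B ** adj_mat (A :: complex^'n^'n)"
  by (simp add: adj_mat_def matrix_matrix_mult_def vec_eq_iff mult.commute)

lemma unitary_carrier:
  "carrier (unitary_group :: (complex^'n^'n) monoid) = {M. M ** adj_mat M = mat 1 \<and> adj_mat M ** M = mat 1}"
  by (simp add: unitary_group_def)

lemma unitary_mult [simp]: "mult (unitary_group :: (complex^'n^'n) monoid) = (**)"
  by (simp add: unitary_group_def)

lemma unitary_one [simp]: "one (unitary_group :: (complex^'n^'n) monoid) = mat 1"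
  by (simp add: unitary_group_def)

lemma unitary_group_group: "group (unitary_group :: (complex^'n^'n) monoid)"
proof (rule groupI)
  fix x y :: "complex^'n^'n"
  assume x: "x \<in> carrier unitary_group" and y: "y \<in> carrier unitary_group"
  have "x ** y ** adj_mat (x ** y) = x ** (y ** adj_mat y) ** adj_mat x"
    by (simp add: adj_mat_mult matrix_mul_assoc)
  moreover have "adj_mat (x ** y) ** (x ** y) = adj_mat y ** (adj_mat x ** x) ** y"
    by (simp add: adj_mat_mult matrix_mul_assoc)
  ultimately show "x \<otimes>\<^bsub>unitary_group\<^esub> y \<in> carrier unitary_group"
    using x y by (simp add: unitary_carrier)
next
  show "\<one>\<^bsub>unitary_group\<^esub> \<in> carrier (unitary_group :: (complex^'n^'n) monoid)"
    by (simp add: unitary_carrier adj_mat_mat)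
next
  fix x y z :: "complex^'n^'n"
  show "x \<otimes>\<^bsub>unitary_group\<^esub> y \<otimes>\<^bsub>unitary_group\<^esub> z = x \<otimes>\<^bsub>unitary_group\<^esub> (y \<otimes>\<^bsub>unitary_group\<^esub> z)"
    by (simp add: matrix_mul_assoc)
next
  fix x :: "complex^'n^'n"
  show "\<one>\<^bsub>unitary_group\<^esub> \<otimes>\<^bsub>unitary_group\<^esub> x = x" by simp
next
  fix x :: "complex^'n^'n"
  assume x: "x \<in> carrier unitary_group"
  then have "adj_mat x \<in> carrier unitary_group"
    by (simp add: unitary_carrier adj_mat_adj_mat)
  then show "\<exists>y\<in>carrier unitary_group. y \<otimes>\<^bsub>unitary_group\<^esub> x = \<one>\<^bsub>unitary_group\<^esub>"
    using x by (auto simp: unitary_carrier)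
qed

lemma unitary_inv: "(x :: complex^'n^'n) \<in> carrier unitary_group \<Longrightarrow> inv\<^bsub>unitary_group\<^esub> x = adj_mat x"
  by (rule group.inv_equality[OF unitary_group_group]) (auto simp: unitary_carrier adj_mat_adj_mat)

text \<open>The scalar circle \<open>S\<^sup>1\<close>: a central subgroup of \<open>U(n)\<close>.\<close>

lemma unit_mult_cnj: "cmod c = 1 \<Longrightarrow> c * cnj c = 1"
  by (metis complex_norm_square of_real_1 power_one)

lemma cnj_mult_unit: "cmod c = 1 \<Longrightarrow> cnj c * c = 1"
  using unit_mult_cnj by (simp add: mult.commute)

lemma scalar_circle_one: "mat 1 \<in> scalar_circle"
  by (force simp: scalar_circle_def)

lemma scalar_circle_mult: "a \<in> scalar_circle \<Longrightarrow> b \<in> scalar_circle \<Longrightarrow> (a ** b :: complex^'n^'n) \<in> scalar_circle"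
  by (auto simp: scalar_circle_def mat_mult_mat norm_mult)

lemma scalar_circle_central: "a \<in> scalar_circle \<Longrightarrow> a ** M = M ** (a :: complex^'n^'n)"
  by (auto simp: scalar_circle_def mat_commute)

lemma scalar_circle_adj: "a \<in> scalar_circle \<Longrightarrow> adj_mat (a :: complex^'n^'n) \<in> scalar_circle"
  by (auto simp: scalar_circle_def adj_mat_mat)

lemma scalar_circle_unitary: "a \<in> scalar_circle \<Longrightarrow> (a :: complex^'n^'n) \<in> carrier unitary_group"
  by (auto simp: scalar_circle_def unitary_carrier adj_mat_mat mat_mult_mat cnj_mult_unit unit_mult_cnj)

lemma scalar_circle_subgroup: "subgroup scalar_circle (unitary_group :: (complex^'n^'n) monoid)"
proof (rule subgroup.intro)
  show "scalar_circle \<subseteq> carrier (unitary_group :: (complex^'n^'n) monoid)"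
    using scalar_circle_unitary by blast
  show "\<And>x y. x \<in> scalar_circle \<Longrightarrow> y \<in> scalar_circle \<Longrightarrow>
      x \<otimes>\<^bsub>unitary_group\<^esub> y \<in> (scalar_circle :: (complex^'n^'n) set)"
    by (simp add: scalar_circle_mult)
  show "\<one>\<^bsub>unitary_group\<^esub> \<in> (scalar_circle :: (complex^'n^'n) set)"
    by (simp add: scalar_circle_one)
  show "\<And>x. x \<in> scalar_circle \<Longrightarrow> inv\<^bsub>unitary_group\<^esub> x \<in> (scalar_circle :: (complex^'n^'n) set)"
    by (simp add: scalar_circle_adj scalar_circle_unitary unitary_inv)
qed

lemma circle_carrier [simp]: "carrier (circle_group :: (complex^'n^'n) monoid) = scalar_circle"
  by (simp add: circle_group_def)

lemma circle_mult [simp]: "mult (circle_group :: (complex^'n^'n) monoid) = (**)"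
  by (simp add: circle_group_def)

lemma circle_one [simp]: "one (circle_group :: (complex^'n^'n) monoid) = mat 1"
  by (simp add: circle_group_def)

lemma circle_group_group: "group (circle_group :: (complex^'n^'n) monoid)"
  unfolding circle_group_def
  by (rule subgroup.subgroup_is_group[OF scalar_circle_subgroup unitary_group_group])

lemma circle_comm_group: "comm_group (circle_group :: (complex^'n^'n) monoid)"
  by (rule group.group_comm_groupI[OF circle_group_group]) (simp add: scalar_circle_central)

lemma circle_pow: "(mat c :: complex^'n^'n) [^]\<^bsub>circle_group\<^esub> (k::nat) = mat (c ^ k)"
  by (induction k) (simp_all add: mat_mult_mat mult.commute)

lemma scalar_circle_cancel:
  assumes "a \<in> scalar_circle" and M: "M \<in> carrier unitary_group" and "a ** M = (M :: complex^'n^'n)"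
  shows "a = mat 1"
proof -
  have "a = a ** (M ** adj_mat M)" using M by (simp add: unitary_carrier)
  also have "\<dots> = (a ** M) ** adj_mat M" by (simp add: matrix_mul_assoc)
  also have "\<dots> = mat 1" using assms by (simp add: unitary_carrier)
  finally show ?thesis .
qed

text \<open>Cosets of \<open>S\<^sup>1\<close> in \<open>U(n)\<close>, i.e.\ the points of \<open>PU(n)\<close>, are compact.\<close>

lemma continuous_on_matrix_mult_right: "continuous_on UNIV (\<lambda>x::complex^'n^'n. x ** M)"
  unfolding matrix_matrix_mult_def by (intro continuous_intros)

lemma continuous_on_mat: "continuous_on UNIV (mat :: complex \<Rightarrow> complex^'n^'n)"
  unfolding mat_def[abs_def]
proof (intro continuous_on_vec_lambda)
  fix i j :: 'n
  show "continuous_on UNIV (\<lambda>k::complex. if i = j then k else 0)"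
    by (cases "i = j") simp_all
qed

lemma compact_scalar_circle: "compact (scalar_circle :: (complex^'n^'n) set)"
proof -
  have "scalar_circle = (mat :: complex \<Rightarrow> complex^'n^'n) ` sphere 0 1"
    by (auto simp: scalar_circle_def)
  moreover have "compact ((mat :: complex \<Rightarrow> complex^'n^'n) ` sphere 0 1)"
    by (rule compact_continuous_image[OF continuous_on_subset[OF continuous_on_mat] compact_sphere])
      simp
  ultimately show ?thesis by (simp only:)
qed

lemma compact_scalar_coset: "compact (scalar_circle #>\<^bsub>unitary_group\<^esub> (M :: complex^'n^'n))"
proof -
  have "scalar_circle #>\<^bsub>unitary_group\<^esub> M = (\<lambda>s. s ** M) ` scalar_circle"
    unfolding r_coset_def by auto
  moreover have "compact ((\<lambda>s. s ** M) ` (scalar_circle :: (complex^'n^'n) set))"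
    by (rule compact_continuous_image[OF continuous_on_subset[OF continuous_on_matrix_mult_right]
          compact_scalar_circle]) simp
  ultimately show ?thesis by (simp only:)
qed

lemma continuous_map_matrix_mult:
  assumes f: "continuous_map X euclidean f" and g: "continuous_map X euclidean g"
  shows "continuous_map X euclidean (\<lambda>x. (f x :: complex^'n^'n) ** (g x :: complex^'n^'n))"
proof -
  have "continuous_on UNIV (\<lambda>p::(complex^'n^'n) \<times> (complex^'n^'n). fst p ** snd p)"
    unfolding matrix_matrix_mult_def by (intro continuous_intros)
  then have mult: "continuous_map euclidean euclidean (\<lambda>p::(complex^'n^'n) \<times> (complex^'n^'n). fst p ** snd p)"
    by simp
  have "continuous_map X euclidean (\<lambda>x. (f x, g x))"
    using continuous_map_pairedI[OF f g] by simp
  from continuous_map_compose[OF this mult] show ?thesis by (simp add: o_def)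
qed

text \<open>Homomorphisms into an abelian group \<open>H\<close> are closed under pointwise products and inverses,
  and so form a group; this gives the group structure on the characters \<open>Hom(Q, S\<^sup>1)\<close>.\<close>

lemma hom_pointwise_mult:
  assumes G: "monoid G" and H: "comm_group H" and f: "f \<in> hom G H" and g: "g \<in> hom G H"
  shows "(\<lambda>x\<in>carrier G. f x \<otimes>\<^bsub>H\<^esub> g x) \<in> hom G H"
proof -
  interpret G: monoid G by (rule G)
  interpret H: comm_group H by (rule H)
  show ?thesis
  proof (rule homI)
    fix x assume x: "x \<in> carrier G"
    then show "(\<lambda>x\<in>carrier G. f x \<otimes>\<^bsub>H\<^esub> g x) x \<in> carrier H"
      using hom_in_carrier[OF f x] hom_in_carrier[OF g x] by simp
  next
    fix x y assume x: "x \<in> carrier G" and y: "y \<in> carrier G"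
    have "f (x \<otimes>\<^bsub>G\<^esub> y) \<otimes>\<^bsub>H\<^esub> g (x \<otimes>\<^bsub>G\<^esub> y) = (f x \<otimes>\<^bsub>H\<^esub> g x) \<otimes>\<^bsub>H\<^esub> (f y \<otimes>\<^bsub>H\<^esub> g y)"
      using f g x y by (simp add: hom_mult hom_in_carrier H.m_ac)
    then show "(\<lambda>x\<in>carrier G. f x \<otimes>\<^bsub>H\<^esub> g x) (x \<otimes>\<^bsub>G\<^esub> y) =
        (\<lambda>x\<in>carrier G. f x \<otimes>\<^bsub>H\<^esub> g x) x \<otimes>\<^bsub>H\<^esub> (\<lambda>x\<in>carrier G. f x \<otimes>\<^bsub>H\<^esub> g x) y"
      using x y by simp
  qed
qed

lemma hom_pointwise_inv:
  assumes G: "monoid G" and H: "comm_group H" and f: "f \<in> hom G H"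
  shows "(\<lambda>x\<in>carrier G. inv\<^bsub>H\<^esub> f x) \<in> hom G H"
proof -
  interpret G: monoid G by (rule G)
  interpret H: comm_group H by (rule H)
  show ?thesis
  proof (rule homI)
    fix x assume x: "x \<in> carrier G"
    then show "(\<lambda>x\<in>carrier G. inv\<^bsub>H\<^esub> f x) x \<in> carrier H"
      using hom_in_carrier[OF f x] by simp
  next
    fix x y assume x: "x \<in> carrier G" and y: "y \<in> carrier G"
    then show "(\<lambda>x\<in>carrier G. inv\<^bsub>H\<^esub> f x) (x \<otimes>\<^bsub>G\<^esub> y) =
        (\<lambda>x\<in>carrier G. inv\<^bsub>H\<^esub> f x) x \<otimes>\<^bsub>H\<^esub> (\<lambda>x\<in>carrier G. inv\<^bsub>H\<^esub> f x) y"
      using f by (simp add: hom_mult hom_in_carrier H.inv_mult)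
  qed
qed

lemma pointwise_hom_group:
  assumes G: "monoid G" and H: "comm_group H"
  shows "group \<lparr>carrier = hom G H \<inter> extensional (carrier G),
                 mult = (\<lambda>f g. \<lambda>x\<in>carrier G. f x \<otimes>\<^bsub>H\<^esub> g x),
                 one = (\<lambda>x\<in>carrier G. \<one>\<^bsub>H\<^esub>)\<rparr>"
    (is "group ?P")
proof -
  interpret G: monoid G by (rule G)
  interpret H: comm_group H by (rule H)
  show ?thesis
  proof (rule groupI)
    fix f g assume "f \<in> carrier ?P" "g \<in> carrier ?P"
    then show "f \<otimes>\<^bsub>?P\<^esub> g \<in> carrier ?P" using hom_pointwise_mult[OF G H] by simp
  next
    have "(\<lambda>x\<in>carrier G. \<one>\<^bsub>H\<^esub>) \<in> hom G H" by (rule homI) auto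
    then show "\<one>\<^bsub>?P\<^esub> \<in> carrier ?P" by simp
  next
    fix f g h assume "f \<in> carrier ?P" "g \<in> carrier ?P" "h \<in> carrier ?P"
    then show "f \<otimes>\<^bsub>?P\<^esub> g \<otimes>\<^bsub>?P\<^esub> h = f \<otimes>\<^bsub>?P\<^esub> (g \<otimes>\<^bsub>?P\<^esub> h)"
      by (auto intro!: restrict_ext simp: hom_in_carrier H.m_assoc)
  next
    fix f assume f: "f \<in> carrier ?P"
    show "\<one>\<^bsub>?P\<^esub> \<otimes>\<^bsub>?P\<^esub> f = f"
      by (rule extensionalityI[where A = "carrier G"]) (use f in \<open>auto simp: hom_in_carrier\<close>)
  next
    fix f assume f: "f \<in> carrier ?P"
    let ?g = "\<lambda>x\<in>carrier G. inv\<^bsub>H\<^esub> f x"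
    have "?g \<in> carrier ?P" using f hom_pointwise_inv[OF G H] by simp
    moreover have "?g \<otimes>\<^bsub>?P\<^esub> f = \<one>\<^bsub>?P\<^esub>"
      using f by (auto intro!: restrict_ext simp: hom_in_carrier)
    ultimately show "\<exists>g\<in>carrier ?P. g \<otimes>\<^bsub>?P\<^esub> f = \<one>\<^bsub>?P\<^esub>" by blast
  qed
qed


text \<open>The topology of pointwise convergence.\<close>

lemma topspace_pointwise_top: "topspace (pointwise_top I :: ('i \<Rightarrow> 'a::topological_space) topology) = extensional I"
  by (auto simp: pointwise_top_def PiE_def)

lemma continuous_map_evaluation: "i \<in> I \<Longrightarrow> continuous_map (pointwise_top I) euclidean (\<lambda>f. f i)"
  unfolding pointwise_top_def by (rule continuous_map_product_projection)

lemma continuous_map_pointwise_top_iff: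
  "continuous_map Z (pointwise_top I) f \<longleftrightarrow>
     f ` topspace Z \<subseteq> extensional I \<and> (\<forall>i\<in>I. continuous_map Z euclidean (\<lambda>z. f z i))"
  unfolding pointwise_top_def by (rule continuous_map_componentwise)

lemma Hausdorff_pointwise_top: "Hausdorff_space (pointwise_top I :: ('i \<Rightarrow> 'a::metric_space) topology)"
  unfolding pointwise_top_def by (simp add: Hausdorff_space_product_topology)


text \<open>Closed and compact sets of functions: products of compact sets are compact, and the
  conditions "is multiplicative" and "takes values in a closed set on \<open>A\<close>" are closed.\<close>

lemma compactin_pointwise_PiE:
  "(\<And>i. i \<in> I \<Longrightarrow> compact (S i)) \<Longrightarrow> compactin (pointwise_top I) (PiE I S)"
  unfolding pointwise_top_def by (simp add: compactin_PiE)

lemma closedin_pointwise_values: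
  assumes A: "A \<subseteq> I" and S: "closed S"
  shows "closedin (pointwise_top I) {\<rho> \<in> topspace (pointwise_top I). \<forall>a\<in>A. \<rho> a \<in> S}"
proof (rule closedin_Collect_ball)
  fix a assume a: "a \<in> A"
  have "continuous_map (pointwise_top I) euclidean (\<lambda>\<rho>. \<rho> a)"
    using a A by (intro continuous_map_evaluation) blast
  moreover have "closedin euclidean S"
    using S closed_closedin by blast
  ultimately show "closedin (pointwise_top I) {\<rho> \<in> topspace (pointwise_top I). \<rho> a \<in> S}"
    by (rule closedin_continuous_map_preimage)
qed

lemma closedin_pointwise_hom:
  assumes "monoid G"
  shows "closedin (pointwise_top (carrier G))
     {\<rho> \<in> topspace (pointwise_top (carrier G)). \<forall>g\<in>carrier G. \<forall>h\<in>carrier G.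
        \<rho> (g \<otimes>\<^bsub>G\<^esub> h) = (\<rho> g :: complex^'n^'n) ** \<rho> h}"
  (is "closedin ?P _")
proof (rule closedin_Collect_ball)
  fix g assume g: "g \<in> carrier G"
  show "closedin ?P {\<rho> \<in> topspace ?P. \<forall>h\<in>carrier G. \<rho> (g \<otimes>\<^bsub>G\<^esub> h) = \<rho> g ** \<rho> h}"
  proof (rule closedin_Collect_ball)
    fix h assume h: "h \<in> carrier G"
    show "closedin ?P {\<rho> \<in> topspace ?P. \<rho> (g \<otimes>\<^bsub>G\<^esub> h) = \<rho> g ** \<rho> h}"
    proof (rule closedin_continuous_maps_eq[OF Hausdorff_space_euclidean])
      show "continuous_map ?P euclidean (\<lambda>\<rho>. \<rho> (g \<otimes>\<^bsub>G\<^esub> h))"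
        using g h monoid.m_closed[OF assms] by (simp add: continuous_map_evaluation)
      show "continuous_map ?P euclidean (\<lambda>\<rho>. \<rho> g ** \<rho> h)"
        using g h by (intro continuous_map_matrix_mult continuous_map_evaluation)
    qed
  qed
qed

text \<open>Two auxiliary constructions for comparing lifts: the pointwise ratio \<open>\<rho>'(g) \<rho>(g)\<^sup>*\<close> of two
  maps into \<open>U(n)\<close>, and the map induced on \<open>G/A\<close> by a function which is constant on cosets.\<close>

definition lift_ratio :: "('g \<Rightarrow> complex^'n^'n) \<Rightarrow> ('g \<Rightarrow> complex^'n^'n) \<Rightarrow> 'g \<Rightarrow> complex^'n^'n"
  where "lift_ratio \<rho>' \<rho> g = \<rho>' g ** adj_mat (\<rho> g)"

definition descend :: "('g, 'b) monoid_scheme \<Rightarrow> 'g set \<Rightarrow> ('g \<Rightarrow> 'c) \<Rightarrow> 'g set \<Rightarrow> 'c"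
  where "descend G A d = (\<lambda>q\<in>carrier (G Mod A). d (SOME g. g \<in> q))"

text \<open>The setting of the theorem: \<open>A\<close> is a normal subgroup of finite index in \<open>\<Gamma> = G\<close>, with
  quotient \<open>Q = G/A\<close>, and \<open>\<psi> : Q \<rightarrow> PU(n)\<close> is a homomorphism. \<open>E\<close> is the space of lifts
  \<open>Hom\<^sub>A(\<Gamma>, U(n))\<^sub>\<psi>\<close>, on which the characters \<open>Hom(Q, S\<^sup>1)\<close> act by multiplication.\<close>

locale projective_lifts =
  fixes G :: "'g monoid" and A :: "'g set" and \<psi> :: "'g set \<Rightarrow> (complex^'n^'n) set"
  assumes group_G: "group G" and normal_A: "A \<lhd> G" and finite_index: "finite (rcosets\<^bsub>G\<^esub> A)"
    and psi_hom: "\<psi> \<in> hom (G Mod A) proj_unitary_group"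
begin

abbreviation E :: "('g \<Rightarrow> complex^'n^'n) set" where "E \<equiv> Hom_A_psi G A \<psi>"

abbreviation X :: "('g set \<Rightarrow> complex^'n^'n) monoid" where "X \<equiv> char_group G A"

abbreviation act where "act \<equiv> char_action G A E"

abbreviation R :: "('g \<Rightarrow> complex^'n^'n) \<Rightarrow> 'g \<Rightarrow> complex^'n^'n"
  where "R \<equiv> \<lambda>\<rho>\<in>E. restrict \<rho> A"

sublocale G: group G by (rule group_G)
sublocale N: normal A G by (rule normal_A)
sublocale U: group "unitary_group :: (complex^'n^'n) monoid" by (rule unitary_group_group)

lemma quotient_group: "group (G Mod A)"
  by (rule N.factorgroup_is_group)

lemma quotient_carrier: "carrier (G Mod A) = rcosets\<^bsub>G\<^esub> A"
  by (simp add: FactGroup_def)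

lemma coset_in_quotient: "g \<in> carrier G \<Longrightarrow> A #>\<^bsub>G\<^esub> g \<in> carrier (G Mod A)"
  using quotient_carrier G.rcosetsI N.subset by auto

lemma quotient_elem: "q \<in> carrier (G Mod A) \<Longrightarrow> \<exists>g\<in>carrier G. q = A #>\<^bsub>G\<^esub> g"
  by (auto simp: quotient_carrier RCOSETS_def)

lemma coset_mult: "g \<in> carrier G \<Longrightarrow> h \<in> carrier G \<Longrightarrow>
    (A #>\<^bsub>G\<^esub> g) \<otimes>\<^bsub>G Mod A\<^esub> (A #>\<^bsub>G\<^esub> h) = A #>\<^bsub>G\<^esub> (g \<otimes>\<^bsub>G\<^esub> h)"
  by (simp add: N.rcos_sum)

lemma coset_of_normal: "a \<in> A \<Longrightarrow> A #>\<^bsub>G\<^esub> a = A"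
  by (simp add: N.rcos_const)

text \<open>Characters of \<open>Q\<close>: the group \<open>X = Hom(Q, S\<^sup>1)\<close> and its basic properties.\<close>

lemma char_carrier:
  "carrier X = hom (G Mod A) (circle_group :: (complex^'n^'n) monoid) \<inter> extensional (carrier (G Mod A))"
  by (simp add: char_group_def)

lemma char_mult: "c1 \<otimes>\<^bsub>X\<^esub> c2 = (\<lambda>q\<in>carrier (G Mod A). c1 q ** c2 q)"
  by (simp add: char_group_def)

lemma char_one: "\<one>\<^bsub>X\<^esub> = (\<lambda>q\<in>carrier (G Mod A). (mat 1 :: complex^'n^'n))"
  by (simp add: char_group_def)

lemma char_value: "c \<in> carrier X \<Longrightarrow> q \<in> carrier (G Mod A) \<Longrightarrow> c q \<in> scalar_circle"
  by (auto simp: char_carrier hom_def)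

lemma char_hom: "c \<in> carrier X \<Longrightarrow> p \<in> carrier (G Mod A) \<Longrightarrow> q \<in> carrier (G Mod A) \<Longrightarrow>
    c (p \<otimes>\<^bsub>G Mod A\<^esub> q) = c p ** c q"
  by (auto simp: char_carrier hom_def)

lemma char_trivial_on_A: "c \<in> carrier X \<Longrightarrow> c A = mat 1"
proof -
  assume c: "c \<in> carrier X"
  have "c \<one>\<^bsub>G Mod A\<^esub> = \<one>\<^bsub>circle_group\<^esub>"
    using c by (intro group_hom.hom_one)
      (auto simp: char_carrier group_hom_def group_hom_axioms_def quotient_group circle_group_group)
  then show ?thesis by simp
qed

lemma char_group_group: "group X"
proof -
  have "X = \<lparr>carrier = hom (G Mod A) circle_group \<inter> extensional (carrier (G Mod A)),
              mult = (\<lambda>f g. \<lambda>x\<in>carrier (G Mod A). f x \<otimes>\<^bsub>circle_group\<^esub> g x),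
              one = (\<lambda>x\<in>carrier (G Mod A). \<one>\<^bsub>circle_group\<^esub>)\<rparr>"
    by (simp add: char_group_def)
  then show ?thesis
    using pointwise_hom_group[OF group.is_monoid[OF quotient_group] circle_comm_group] by simp
qed

text \<open>Since \<open>Q\<close> has finite order \<open>m\<close>, characters take values in the \<open>m\<close>-th roots of unity,
  so there are only finitely many of them.\<close>
lemma char_group_finite: "finite (carrier X)"
proof -
  let ?m = "order (G Mod A)"
  have m: "?m > 0"
    using finite_index quotient_carrier
    by (metis card_gt_0_iff empty_iff group.is_monoid quotient_group monoid.one_closed order_def)
  have "carrier X \<subseteq> PiE (carrier (G Mod A)) (\<lambda>_. mat ` {z. z ^ ?m = 1})"
  proof
    fix c assume c: "c \<in> carrier X"
    have "c q \<in> mat ` {z. z ^ ?m = 1}" if q: "q \<in> carrier (G Mod A)" for q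
    proof -
      obtain z where z: "c q = mat z" using char_value[OF c q] by (auto simp: scalar_circle_def)
      have "c (q [^]\<^bsub>G Mod A\<^esub> ?m) = c q [^]\<^bsub>circle_group\<^esub> ?m"
        using c q by (intro hom_nat_pow) (auto simp: char_carrier quotient_group circle_group_group)
      moreover have "q [^]\<^bsub>G Mod A\<^esub> ?m = A"
        using group.pow_order_eq_1[OF quotient_group q] finite_index quotient_carrier by simp
      ultimately have "mat (z ^ ?m) = (mat 1 :: complex^'n^'n)"
        using char_trivial_on_A[OF c] z by (simp add: circle_pow)
      then show ?thesis using z mat_inject by blast
    qed
    moreover have "c \<in> extensional (carrier (G Mod A))" using c by (simp add: char_carrier)
    ultimately show "c \<in> PiE (carrier (G Mod A)) (\<lambda>_. mat ` {z. z ^ ?m = 1})"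
      by (simp add: PiE_iff)
  qed
  moreover have "finite (PiE (carrier (G Mod A)) (\<lambda>_. mat ` {z::complex. z ^ ?m = 1} :: (complex^'n^'n) set))"
    using finite_roots_unity[of ?m] m finite_index quotient_carrier by (intro finite_PiE) auto
  ultimately show ?thesis by (rule finite_subset)
qed

text \<open>The values of \<open>\<psi>\<close> are cosets \<open>S\<^sup>1 M\<close> of unitary matrices; a unitary matrix lies in such
  a coset exactly when it represents it.\<close>

lemma psi_value: "g \<in> carrier G \<Longrightarrow> \<exists>M\<in>carrier unitary_group. \<psi> (A #>\<^bsub>G\<^esub> g) = scalar_circle #>\<^bsub>unitary_group\<^esub> M"
proof -
  assume g: "g \<in> carrier G"
  have "\<psi> (A #>\<^bsub>G\<^esub> g) \<in> carrier proj_unitary_group"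
    using psi_hom coset_in_quotient[OF g] by (simp add: hom_def Pi_def)
  then show ?thesis by (auto simp: proj_unitary_group_def FactGroup_def RCOSETS_def)
qed

lemma mem_psi_iff:
  assumes g: "g \<in> carrier G" and M: "M \<in> carrier unitary_group"
  shows "M \<in> \<psi> (A #>\<^bsub>G\<^esub> g) \<longleftrightarrow> \<psi> (A #>\<^bsub>G\<^esub> g) = scalar_circle #>\<^bsub>unitary_group\<^esub> M"
proof -
  obtain M0 where M0: "M0 \<in> carrier unitary_group"
    and psi: "\<psi> (A #>\<^bsub>G\<^esub> g) = scalar_circle #>\<^bsub>unitary_group\<^esub> M0"
    using psi_value[OF g] by blast
  show ?thesis
    using psi U.rcos_self[OF M scalar_circle_subgroup] U.repr_independence[OF _ M0 scalar_circle_subgroup]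
    by auto
qed

lemma psi_unitary: "g \<in> carrier G \<Longrightarrow> \<psi> (A #>\<^bsub>G\<^esub> g) \<subseteq> carrier unitary_group"
  using psi_value U.r_coset_subset_G[OF subgroup.subset[OF scalar_circle_subgroup]] by fastforce

lemma psi_scalar_closed:
  assumes g: "g \<in> carrier G" and s: "s \<in> scalar_circle" and M: "M \<in> \<psi> (A #>\<^bsub>G\<^esub> g)"
  shows "s ** M \<in> \<psi> (A #>\<^bsub>G\<^esub> g)"
proof -
  obtain M0 where psi: "\<psi> (A #>\<^bsub>G\<^esub> g) = scalar_circle #>\<^bsub>unitary_group\<^esub> M0"
    using psi_value[OF g] by blast
  then obtain t where t: "t \<in> scalar_circle" and "M = t ** M0"
    using M by (auto simp: r_coset_def)
  then have "s ** M = (s ** t) ** M0" by (simp add: matrix_mul_assoc)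
  then show ?thesis using psi scalar_circle_mult[OF s t] by (auto simp: r_coset_def)
qed

text \<open>Membership in \<open>E\<close>: a homomorphism \<open>G \<rightarrow> U(n)\<close>, scalar on \<open>A\<close>, lifting \<open>\<psi>\<close>.\<close>

lemma lift_hom: "\<rho> \<in> E \<Longrightarrow> g \<in> carrier G \<Longrightarrow> h \<in> carrier G \<Longrightarrow> \<rho> (g \<otimes>\<^bsub>G\<^esub> h) = \<rho> g ** \<rho> h"
  by (auto simp: Hom_A_psi_def Hom_A_def Hom_rep_def hom_def)

lemma lift_unitary: "\<rho> \<in> E \<Longrightarrow> g \<in> carrier G \<Longrightarrow> \<rho> g \<in> carrier unitary_group"
  by (auto simp: Hom_A_psi_def Hom_A_def Hom_rep_def hom_def)

lemma lift_extensional: "\<rho> \<in> E \<Longrightarrow> \<rho> \<in> extensional (carrier G)"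
  by (auto simp: Hom_A_psi_def Hom_A_def Hom_rep_def)

lemma lift_scalar_on_A: "\<rho> \<in> E \<Longrightarrow> a \<in> A \<Longrightarrow> \<rho> a \<in> scalar_circle"
  by (auto simp: Hom_A_psi_def Hom_A_def)

lemma lift_coset: "\<rho> \<in> E \<Longrightarrow> g \<in> carrier G \<Longrightarrow> \<psi> (A #>\<^bsub>G\<^esub> g) = scalar_circle #>\<^bsub>unitary_group\<^esub> \<rho> g"
  by (auto simp: Hom_A_psi_def)

lemma lift_in_psi: "\<rho> \<in> E \<Longrightarrow> g \<in> carrier G \<Longrightarrow> \<rho> g \<in> \<psi> (A #>\<^bsub>G\<^esub> g)"
  using mem_psi_iff lift_coset lift_unitary by blast

lemma lift_eq:
  "E = {\<rho> \<in> PiE (carrier G) (\<lambda>g. \<psi> (A #>\<^bsub>G\<^esub> g)).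
          (\<forall>g\<in>carrier G. \<forall>h\<in>carrier G. \<rho> (g \<otimes>\<^bsub>G\<^esub> h) = \<rho> g ** \<rho> h) \<and> (\<forall>a\<in>A. \<rho> a \<in> scalar_circle)}"
proof (intro equalityI subsetI)
  fix \<rho> assume "\<rho> \<in> E"
  then show "\<rho> \<in> {\<rho> \<in> PiE (carrier G) (\<lambda>g. \<psi> (A #>\<^bsub>G\<^esub> g)).
      (\<forall>g\<in>carrier G. \<forall>h\<in>carrier G. \<rho> (g \<otimes>\<^bsub>G\<^esub> h) = \<rho> g ** \<rho> h) \<and> (\<forall>a\<in>A. \<rho> a \<in> scalar_circle)}"
    by (simp add: PiE_iff lift_extensional lift_in_psi lift_hom lift_scalar_on_A)
next
  fix \<rho> assume "\<rho> \<in> {\<rho> \<in> PiE (carrier G) (\<lambda>g. \<psi> (A #>\<^bsub>G\<^esub> g)).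
      (\<forall>g\<in>carrier G. \<forall>h\<in>carrier G. \<rho> (g \<otimes>\<^bsub>G\<^esub> h) = \<rho> g ** \<rho> h) \<and> (\<forall>a\<in>A. \<rho> a \<in> scalar_circle)}"
  then have \<rho>: "\<rho> \<in> extensional (carrier G)" "\<And>g. g \<in> carrier G \<Longrightarrow> \<rho> g \<in> \<psi> (A #>\<^bsub>G\<^esub> g)"
    "\<And>g h. g \<in> carrier G \<Longrightarrow> h \<in> carrier G \<Longrightarrow> \<rho> (g \<otimes>\<^bsub>G\<^esub> h) = \<rho> g ** \<rho> h"
    "\<And>a. a \<in> A \<Longrightarrow> \<rho> a \<in> scalar_circle"
    by (auto simp: PiE_iff)
  have unitary: "\<rho> g \<in> carrier unitary_group" if "g \<in> carrier G" for g
    using psi_unitary[OF that] \<rho>(2)[OF that] by blast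
  show "\<rho> \<in> E"
    unfolding Hom_A_psi_def Hom_A_def Hom_rep_def
    using \<rho> unitary mem_psi_iff by (auto intro!: homI)
qed

text \<open>The action of the characters on the lifts.\<close>

lemma act_eq: "\<rho> \<in> E \<Longrightarrow> act c \<rho> = (\<lambda>g\<in>carrier G. c (A #>\<^bsub>G\<^esub> g) ** \<rho> g)"
  by (simp add: char_action_def)

lemma act_closed:
  assumes c: "c \<in> carrier X" and \<rho>: "\<rho> \<in> E"
  shows "act c \<rho> \<in> E"
proof -
  let ?\<sigma> = "\<lambda>g\<in>carrier G. c (A #>\<^bsub>G\<^esub> g) ** \<rho> g"
  have char_scalar: "c (A #>\<^bsub>G\<^esub> g) \<in> scalar_circle" if "g \<in> carrier G" for g
    by (rule char_value[OF c coset_in_quotient[OF that]])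
  have "?\<sigma> (g \<otimes>\<^bsub>G\<^esub> h) = ?\<sigma> g ** ?\<sigma> h" if g: "g \<in> carrier G" and h: "h \<in> carrier G" for g h
  proof -
    have "?\<sigma> (g \<otimes>\<^bsub>G\<^esub> h) = c (A #>\<^bsub>G\<^esub> g) ** c (A #>\<^bsub>G\<^esub> h) ** (\<rho> g ** \<rho> h)"
      using char_hom[OF c coset_in_quotient[OF g] coset_in_quotient[OF h]] coset_mult[OF g h]
        lift_hom[OF \<rho> g h] g h by simp
    also have "\<dots> = c (A #>\<^bsub>G\<^esub> g) ** (c (A #>\<^bsub>G\<^esub> h) ** \<rho> g) ** \<rho> h"
      by (simp add: matrix_mul_assoc)
    also have "\<dots> = c (A #>\<^bsub>G\<^esub> g) ** (\<rho> g ** c (A #>\<^bsub>G\<^esub> h)) ** \<rho> h"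
      by (simp only: scalar_circle_central[OF char_scalar[OF h]])
    also have "\<dots> = ?\<sigma> g ** ?\<sigma> h"
      using g h by (simp add: matrix_mul_assoc)
    finally show ?thesis .
  qed
  moreover have "?\<sigma> a \<in> scalar_circle" if a: "a \<in> A" for a
    using a N.subset coset_of_normal[OF a] char_trivial_on_A[OF c] lift_scalar_on_A[OF \<rho> a] by auto
  moreover have "?\<sigma> g \<in> \<psi> (A #>\<^bsub>G\<^esub> g)" if g: "g \<in> carrier G" for g
    using psi_scalar_closed[OF g char_scalar[OF g] lift_in_psi[OF \<rho> g]] g by simp
  ultimately have "?\<sigma> \<in> E"
    unfolding lift_eq by (simp add: PiE_iff)
  then show ?thesis using \<rho> by (simp add: act_eq)
qed

lemma act_mult:
  assumes c1: "c1 \<in> carrier X" and c2: "c2 \<in> carrier X" and \<rho>: "\<rho> \<in> E"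
  shows "act (c1 \<otimes>\<^bsub>X\<^esub> c2) \<rho> = act c1 (act c2 \<rho>)"
proof -
  have "act c1 (act c2 \<rho>) = (\<lambda>g\<in>carrier G. c1 (A #>\<^bsub>G\<^esub> g) ** act c2 \<rho> g)"
    by (rule act_eq[OF act_closed[OF c2 \<rho>]])
  also have "\<dots> = (\<lambda>g\<in>carrier G. c1 (A #>\<^bsub>G\<^esub> g) ** (c2 (A #>\<^bsub>G\<^esub> g) ** \<rho> g))"
    by (rule restrict_ext) (simp add: act_eq[OF \<rho>])
  also have "\<dots> = act (c1 \<otimes>\<^bsub>X\<^esub> c2) \<rho>"
    unfolding act_eq[OF \<rho>] char_mult
    by (rule restrict_ext) (simp add: coset_in_quotient matrix_mul_assoc)
  finally show ?thesis by simp
qed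

lemma act_one: "\<rho> \<in> E \<Longrightarrow> act \<one>\<^bsub>X\<^esub> \<rho> = \<rho>"
  using lift_extensional[of \<rho>]
  by (auto simp: act_eq char_one coset_in_quotient extensional_restrict cong: restrict_cong)

lemma char_action_group_action: "group_action X E act"
proof -
  interpret X: group X by (rule char_group_group)
  have bij: "act c \<in> Bij E" if c: "c \<in> carrier X" for c
  proof -
    have "bij_betw (act c) E E"
    proof (rule bij_betw_byWitness[where f' = "act (inv\<^bsub>X\<^esub> c)"])
      show "\<forall>a\<in>E. act (inv\<^bsub>X\<^esub> c) (act c a) = a" "\<forall>a\<in>E. act c (act (inv\<^bsub>X\<^esub> c) a) = a"
        using c by (auto simp: act_mult[symmetric] act_one)
      show "act c ` E \<subseteq> E" "act (inv\<^bsub>X\<^esub> c) ` E \<subseteq> E"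
        using c act_closed by auto
    qed
    moreover have "act c \<in> extensional E" by (simp add: char_action_def)
    ultimately show ?thesis by (simp add: Bij_def)
  qed
  have "act \<in> hom X (BijGroup E)"
  proof (rule homI)
    fix c assume "c \<in> carrier X"
    then show "act c \<in> carrier (BijGroup E)" using bij by (simp add: BijGroup_def)
  next
    fix c1 c2 assume c1: "c1 \<in> carrier X" and c2: "c2 \<in> carrier X"
    have "act (c1 \<otimes>\<^bsub>X\<^esub> c2) = compose E (act c1) (act c2)"
    proof (rule ext)
      fix \<rho> show "act (c1 \<otimes>\<^bsub>X\<^esub> c2) \<rho> = compose E (act c1) (act c2) \<rho>"
        using act_mult[OF c1 c2] by (cases "\<rho> \<in> E") (simp_all add: compose_def char_action_def)
    qed
    then show "act (c1 \<otimes>\<^bsub>X\<^esub> c2) = act c1 \<otimes>\<^bsub>BijGroup E\<^esub> act c2"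
      using bij c1 c2 by (simp add: BijGroup_def)
  qed
  then show ?thesis
    unfolding group_action_def group_hom_def group_hom_axioms_def
    using char_group_group group_BijGroup by blast
qed

text \<open>The action is free: \<open>\<chi>(q) \<rho>(g) = \<rho>(g)\<close> forces the scalar \<open>\<chi>(q)\<close> to be \<open>1\<close>.\<close>
lemma char_action_free: "c \<in> carrier X \<Longrightarrow> \<rho> \<in> E \<Longrightarrow> act c \<rho> = \<rho> \<Longrightarrow> c = \<one>\<^bsub>X\<^esub>"
proof -
  assume c: "c \<in> carrier X" and \<rho>: "\<rho> \<in> E" and fixed: "act c \<rho> = \<rho>"
  show "c = \<one>\<^bsub>X\<^esub>"
  proof (rule extensionalityI[where A = "carrier (G Mod A)"])
    show "c \<in> extensional (carrier (G Mod A))" using c by (simp add: char_carrier)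
    show "\<one>\<^bsub>X\<^esub> \<in> extensional (carrier (G Mod A))" by (simp add: char_one)
    fix q assume q: "q \<in> carrier (G Mod A)"
    then obtain g where g: "g \<in> carrier G" and q_eq: "q = A #>\<^bsub>G\<^esub> g"
      using quotient_elem by blast
    have "c q ** \<rho> g = \<rho> g"
      using fun_cong[OF fixed, of g] g q_eq by (simp add: act_eq[OF \<rho>])
    then have "c q = mat 1"
      using scalar_circle_cancel char_value[OF c q] lift_unitary[OF \<rho> g] by blast
    then show "c q = \<one>\<^bsub>X\<^esub> q" using q by (simp add: char_one)
  qed
qed

lemma restriction_invariant:
  assumes c: "c \<in> carrier X" and \<rho>: "\<rho> \<in> E"
  shows "R (act c \<rho>) = R \<rho>"
proof -
  have "restrict (act c \<rho>) A = restrict \<rho> A"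
  proof (rule restrict_ext)
    fix a assume a: "a \<in> A"
    then have "a \<in> carrier G" using N.subset by blast
    then show "act c \<rho> a = \<rho> a"
      using coset_of_normal[OF a] char_trivial_on_A[OF c] by (simp add: act_eq[OF \<rho>])
  qed
  then show ?thesis using act_closed[OF c \<rho>] \<rho> by simp
qed

text \<open>Two lifts with the same restriction to \<open>A\<close> differ by a character. Their ratio
  \<open>d(g) = \<rho>'(g) \<rho>(g)\<^sup>*\<close> is scalar (both lift \<open>\<psi>\<close>), multiplicative (scalars are central) and
  constant on cosets of \<open>A\<close> (the lifts agree on \<open>A\<close>), hence descends to a character of \<open>Q\<close>.\<close>

lemma lift_ratio_mult_right:
  assumes "\<rho> \<in> E" and "g \<in> carrier G"
  shows "lift_ratio \<rho>' \<rho> g ** \<rho> g = \<rho>' g"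
proof -
  have "lift_ratio \<rho>' \<rho> g ** \<rho> g = \<rho>' g ** (adj_mat (\<rho> g) ** \<rho> g)"
    by (simp add: lift_ratio_def matrix_mul_assoc)
  then show ?thesis using lift_unitary[OF assms] by (simp add: unitary_carrier)
qed

lemma lift_ratio_scalar:
  assumes \<rho>: "\<rho> \<in> E" and \<rho>': "\<rho>' \<in> E" and g: "g \<in> carrier G"
  shows "lift_ratio \<rho>' \<rho> g \<in> scalar_circle"
proof -
  have "\<rho>' g \<in> scalar_circle #>\<^bsub>unitary_group\<^esub> \<rho> g"
    using lift_in_psi[OF \<rho>' g] lift_coset[OF \<rho> g] by simp
  then obtain s where s: "s \<in> scalar_circle" and "\<rho>' g = s ** \<rho> g"
    by (auto simp: r_coset_def)
  then have "lift_ratio \<rho>' \<rho> g = s ** (\<rho> g ** adj_mat (\<rho> g))"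
    by (simp add: lift_ratio_def matrix_mul_assoc)
  then show ?thesis using s lift_unitary[OF \<rho> g] by (simp add: unitary_carrier)
qed

lemma lift_ratio_mult:
  assumes \<rho>: "\<rho> \<in> E" and \<rho>': "\<rho>' \<in> E" and g: "g \<in> carrier G" and h: "h \<in> carrier G"
  shows "lift_ratio \<rho>' \<rho> (g \<otimes>\<^bsub>G\<^esub> h) = lift_ratio \<rho>' \<rho> g ** lift_ratio \<rho>' \<rho> h"
proof -
  let ?d = "lift_ratio \<rho>' \<rho>"
  have "?d (g \<otimes>\<^bsub>G\<^esub> h) = \<rho>' g ** ?d h ** adj_mat (\<rho> g)"
    by (simp add: lift_ratio_def lift_hom[OF \<rho> g h] lift_hom[OF \<rho>' g h] adj_mat_mult
        matrix_mul_assoc)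
  also have "\<dots> = ?d h ** ?d g"
    using scalar_circle_central[OF lift_ratio_scalar[OF \<rho> \<rho>' h], of "\<rho>' g"]
    by (simp add: lift_ratio_def matrix_mul_assoc)
  also have "\<dots> = ?d g ** ?d h" by (rule scalar_circle_central[OF lift_ratio_scalar[OF \<rho> \<rho>' h]])
  finally show ?thesis .
qed

lemma lift_ratio_coset:
  assumes \<rho>: "\<rho> \<in> E" and \<rho>': "\<rho>' \<in> E" and eq: "R \<rho>' = R \<rho>"
    and a: "a \<in> A" and g: "g \<in> carrier G"
  shows "lift_ratio \<rho>' \<rho> (a \<otimes>\<^bsub>G\<^esub> g) = lift_ratio \<rho>' \<rho> g"
proof -
  let ?d = "lift_ratio \<rho>' \<rho>"
  have aG: "a \<in> carrier G" using a N.subset by blast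
  have agree: "\<rho>' a = \<rho> a" using fun_cong[OF eq, of a] a \<rho> \<rho>' by simp
  have "?d (a \<otimes>\<^bsub>G\<^esub> g) = \<rho> a ** ?d g ** adj_mat (\<rho> a)"
    by (simp add: lift_ratio_def lift_hom[OF \<rho> aG g] lift_hom[OF \<rho>' aG g] agree adj_mat_mult
        matrix_mul_assoc)
  also have "\<dots> = ?d g ** (\<rho> a ** adj_mat (\<rho> a))"
    by (simp add: scalar_circle_central[OF lift_ratio_scalar[OF \<rho> \<rho>' g], of "\<rho> a"]
        matrix_mul_assoc)
  also have "\<dots> = ?d g" using lift_unitary[OF \<rho> aG] by (simp add: unitary_carrier)
  finally show ?thesis .
qed

text \<open>A function on \<open>G\<close> that is constant on the cosets of \<open>A\<close> descends to \<open>G/A\<close>; if it is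
  moreover a scalar-valued homomorphism, it descends to a character.\<close>

lemma descend_coset:
  assumes invariant: "\<forall>a\<in>A. \<forall>g\<in>carrier G. d (a \<otimes>\<^bsub>G\<^esub> g) = d g"
    and g: "g \<in> carrier G"
  shows "descend G A d (A #>\<^bsub>G\<^esub> g) = d g"
proof -
  have "(SOME g'. g' \<in> A #>\<^bsub>G\<^esub> g) \<in> A #>\<^bsub>G\<^esub> g"
    using G.rcos_self[OF g N.subgroup_axioms] by (rule someI)
  then obtain a where a: "a \<in> A" and some: "(SOME g'. g' \<in> A #>\<^bsub>G\<^esub> g) = a \<otimes>\<^bsub>G\<^esub> g"
    by (auto simp: r_coset_def)
  show ?thesis
    using coset_in_quotient[OF g] invariant a g some by (simp add: descend_def)
qed

lemma descend_character:
  assumes invariant: "\<forall>a\<in>A. \<forall>g\<in>carrier G. d (a \<otimes>\<^bsub>G\<^esub> g) = d g"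
    and scalar: "\<forall>g\<in>carrier G. d g \<in> scalar_circle"
    and mult: "\<forall>g\<in>carrier G. \<forall>h\<in>carrier G. d (g \<otimes>\<^bsub>G\<^esub> h) = d g ** d h"
  shows "descend G A d \<in> carrier X"
  unfolding char_carrier
proof
  show "descend G A d \<in> hom (G Mod A) circle_group"
  proof (rule homI)
    fix q assume "q \<in> carrier (G Mod A)"
    then obtain g where "g \<in> carrier G" "q = A #>\<^bsub>G\<^esub> g" using quotient_elem by blast
    then show "descend G A d q \<in> carrier circle_group"
      using descend_coset[OF invariant] scalar by simp
  next
    fix p q assume p: "p \<in> carrier (G Mod A)" and q: "q \<in> carrier (G Mod A)"
    obtain g h where g: "g \<in> carrier G" "p = A #>\<^bsub>G\<^esub> g" and h: "h \<in> carrier G" "q = A #>\<^bsub>G\<^esub> h"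
      using quotient_elem[OF p] quotient_elem[OF q] by blast
    have gh: "g \<otimes>\<^bsub>G\<^esub> h \<in> carrier G" using g h by simp
    show "descend G A d (p \<otimes>\<^bsub>G Mod A\<^esub> q) = descend G A d p \<otimes>\<^bsub>circle_group\<^esub> descend G A d q"
      using coset_mult[OF g(1) h(1)] descend_coset[OF invariant gh] mult g h
        descend_coset[OF invariant g(1)] descend_coset[OF invariant h(1)] by simp
  qed
qed (simp add: descend_def)

lemma same_restriction_imp_orbit:
  assumes \<rho>: "\<rho> \<in> E" and \<rho>': "\<rho>' \<in> E" and eq: "R \<rho>' = R \<rho>"
  shows "\<exists>c\<in>carrier X. act c \<rho> = \<rho>'"
proof
  let ?c = "descend G A (lift_ratio \<rho>' \<rho>)"
  have invariant: "\<forall>a\<in>A. \<forall>g\<in>carrier G. lift_ratio \<rho>' \<rho> (a \<otimes>\<^bsub>G\<^esub> g) = lift_ratio \<rho>' \<rho> g"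
    using lift_ratio_coset[OF \<rho> \<rho>' eq] by blast
  show "?c \<in> carrier X"
    using lift_ratio_scalar[OF \<rho> \<rho>'] lift_ratio_mult[OF \<rho> \<rho>']
    by (intro descend_character[OF invariant]) auto
  show "act ?c \<rho> = \<rho>'"
  proof (rule extensionalityI[where A = "carrier G"])
    show "act ?c \<rho> \<in> extensional (carrier G)" by (simp add: act_eq[OF \<rho>])
    show "\<rho>' \<in> extensional (carrier G)" by (rule lift_extensional[OF \<rho>'])
    fix g assume g: "g \<in> carrier G"
    then show "act ?c \<rho> g = \<rho>' g"
      by (simp add: act_eq[OF \<rho>] descend_coset[OF invariant g] lift_ratio_mult_right[OF \<rho> g])
  qed
qed

text \<open>The fibres of the restriction map \<open>R\<close> are exactly the orbits of the action.\<close>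
lemma restriction_fibre_eq_orbit:
  assumes \<rho>: "\<rho> \<in> E"
  shows "{\<rho>' \<in> E. R \<rho>' = R \<rho>} = orbit X act \<rho>"
proof (intro equalityI subsetI)
  fix \<rho>' assume "\<rho>' \<in> {\<rho>' \<in> E. R \<rho>' = R \<rho>}"
  then obtain c where "c \<in> carrier X" "act c \<rho> = \<rho>'"
    using same_restriction_imp_orbit[OF \<rho>] by blast
  then show "\<rho>' \<in> orbit X act \<rho>" unfolding orbit_def by blast
next
  fix \<rho>' assume "\<rho>' \<in> orbit X act \<rho>"
  then show "\<rho>' \<in> {\<rho>' \<in> E. R \<rho>' = R \<rho>}"
    using act_closed[OF _ \<rho>] restriction_invariant[OF _ \<rho>] by (auto simp: orbit_def)
qed

lemma restriction_image: "\<rho> \<in> E \<Longrightarrow> R \<rho> \<in> Hom_circle G A"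
  unfolding Hom_circle_def
proof
  assume \<rho>: "\<rho> \<in> E"
  show "R \<rho> \<in> hom (G\<lparr>carrier := A\<rparr>) circle_group"
  proof (rule homI)
    fix a assume "a \<in> carrier (G\<lparr>carrier := A\<rparr>)"
    then show "R \<rho> a \<in> carrier circle_group" using lift_scalar_on_A[OF \<rho>] \<rho> by simp
  next
    fix a b assume "a \<in> carrier (G\<lparr>carrier := A\<rparr>)" and "b \<in> carrier (G\<lparr>carrier := A\<rparr>)"
    then have "a \<in> A" "b \<in> A" by auto
    then show "R \<rho> (a \<otimes>\<^bsub>G\<lparr>carrier := A\<rparr>\<^esub> b) = R \<rho> a \<otimes>\<^bsub>circle_group\<^esub> R \<rho> b"
      using lift_hom[OF \<rho>] N.subset N.m_closed \<rho> by auto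
  qed
qed simp

text \<open>Topology of the space of lifts: \<open>E\<close> is a closed subset of the compact product
  \<open>\<Prod>\<^sub>g \<psi>(gA)\<close>, hence compact; the action and the restriction map are continuous.\<close>

abbreviation lifts_top :: "('g \<Rightarrow> complex^'n^'n) topology"
  where "lifts_top \<equiv> subtopology (pointwise_top (carrier G)) E"

abbreviation restrictions_top :: "('g \<Rightarrow> complex^'n^'n) topology"
  where "restrictions_top \<equiv> subtopology (pointwise_top A) (R ` E)"

lemma topspace_lifts_top: "topspace lifts_top = E"
  using lift_extensional by (auto simp: topspace_pointwise_top)

lemma topspace_restrictions_top: "topspace restrictions_top = R ` E"
  by (auto simp: topspace_pointwise_top)

lemma compact_lifts: "compact_space lifts_top"
proof -
  let ?P = "pointwise_top (carrier G) :: ('g \<Rightarrow> complex^'n^'n) topology"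
  let ?K = "PiE (carrier G) (\<lambda>g. \<psi> (A #>\<^bsub>G\<^esub> g))"
  have compact_psi: "compact (\<psi> (A #>\<^bsub>G\<^esub> g))" if "g \<in> carrier G" for g
    using psi_value[OF that] compact_scalar_coset by auto
  have K: "compactin ?P ?K"
    by (intro compactin_pointwise_PiE compact_psi)
  have E_eq: "E = ?K \<inter> {\<rho> \<in> topspace ?P. \<forall>g\<in>carrier G. \<forall>h\<in>carrier G. \<rho> (g \<otimes>\<^bsub>G\<^esub> h) = \<rho> g ** \<rho> h}
      \<inter> {\<rho> \<in> topspace ?P. \<forall>a\<in>A. \<rho> a \<in> scalar_circle}"
    by (subst lift_eq) (auto simp: topspace_pointwise_top PiE_iff extensional_def)
  have "closedin ?P E"
    unfolding E_eq
    using compactin_imp_closedin[OF Hausdorff_pointwise_top K] closedin_pointwise_hom[OF G.is_monoid]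
      closedin_pointwise_values[OF N.subset compact_imp_closed[OF compact_scalar_circle]]
    by (intro closedin_Int)
  moreover have "E \<subseteq> ?K"
    by (subst E_eq) blast
  ultimately have "compactin ?P E"
    using closed_compactin[OF K] by blast
  then show ?thesis by (rule compact_space_subtopology)
qed

lemma restriction_continuous: "continuous_map lifts_top restrictions_top R"
proof -
  have "continuous_map lifts_top (pointwise_top A) R"
    unfolding continuous_map_pointwise_top_iff
  proof
    show "R ` topspace lifts_top \<subseteq> extensional A" by (auto simp: topspace_lifts_top)
    show "\<forall>a\<in>A. continuous_map lifts_top euclidean (\<lambda>\<rho>. R \<rho> a)"
    proof
      fix a assume a: "a \<in> A"
      have "continuous_map lifts_top euclidean (\<lambda>\<rho>. \<rho> a)"
        using a N.subset by (intro continuous_map_from_subtopology continuous_map_evaluation) auto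
      then show "continuous_map lifts_top euclidean (\<lambda>\<rho>. R \<rho> a)"
        by (rule continuous_map_eq) (use a in \<open>simp add: topspace_lifts_top\<close>)
    qed
  qed
  then show ?thesis by (simp add: continuous_map_in_subtopology topspace_lifts_top)
qed

lemma act_continuous: "c \<in> carrier X \<Longrightarrow> continuous_map lifts_top lifts_top (act c)"
proof -
  assume c: "c \<in> carrier X"
  have "continuous_map lifts_top (pointwise_top (carrier G)) (\<lambda>\<rho>. \<lambda>g\<in>carrier G. c (A #>\<^bsub>G\<^esub> g) ** \<rho> g)"
    unfolding continuous_map_pointwise_top_iff
  proof
    show "(\<lambda>\<rho>. \<lambda>g\<in>carrier G. c (A #>\<^bsub>G\<^esub> g) ** \<rho> g) ` topspace lifts_top \<subseteq> extensional (carrier G)"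
      by auto
    show "\<forall>g\<in>carrier G. continuous_map lifts_top euclidean (\<lambda>\<rho>. (\<lambda>g\<in>carrier G. c (A #>\<^bsub>G\<^esub> g) ** \<rho> g) g)"
    proof
      fix g assume g: "g \<in> carrier G"
      have "continuous_map lifts_top euclidean (\<lambda>\<rho>. c (A #>\<^bsub>G\<^esub> g) ** \<rho> g)"
        using g by (intro continuous_map_matrix_mult continuous_map_from_subtopology
            continuous_map_evaluation) auto
      then show "continuous_map lifts_top euclidean (\<lambda>\<rho>. (\<lambda>g\<in>carrier G. c (A #>\<^bsub>G\<^esub> g) ** \<rho> g) g)"
        using g by simp
    qed
  qed
  then have "continuous_map lifts_top (pointwise_top (carrier G)) (act c)"
    by (rule continuous_map_eq) (simp add: topspace_lifts_top act_eq)
  then show ?thesis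
    using act_closed[OF c] by (auto simp: continuous_map_in_subtopology topspace_lifts_top)
qed

text \<open>Hence restriction is the projection of the orbit space of the character action.\<close>
lemma restriction_orbit_projection: "orbit_projection X lifts_top act restrictions_top R"
  unfolding orbit_projection_def orbit_projection_axioms_def topspace_lifts_top
proof (intro conjI allI impI)
  show "group_action X E act" by (rule char_action_group_action)
  show "continuous_map lifts_top lifts_top (act c)" if "c \<in> carrier X" for c
    by (rule act_continuous[OF that])
  show "continuous_map lifts_top restrictions_top R" by (rule restriction_continuous)
  show "closed_map lifts_top restrictions_top R"
    by (rule continuous_imp_closed_map[OF restriction_continuous compact_lifts])
      (intro Hausdorff_space_subtopology Hausdorff_pointwise_top)
  show "R ` E = topspace restrictions_top" by (rule topspace_restrictions_top[symmetric])
  show "{\<rho>' \<in> E. R \<rho>' = R \<rho>} = orbit X act \<rho>" if "\<rho> \<in> E" for \<rho>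
    by (rule restriction_fibre_eq_orbit[OF that])
qed

end

text \<open>Main theorem: the character group \<open>Hom(Q, S\<^sup>1)\<close> is finite and acts freely on the
  lifts \<open>Hom\<^sub>A(\<Gamma>, U(n))\<^sub>\<psi>\<close>; restriction to \<open>A\<close> identifies the orbit space with its image
  and is a finite covering map whose fibres are the orbits.\<close>

theorem mainTheorem19:
  fixes G :: "'g monoid" and A :: "'g set"
    and \<psi> :: "'g set \<Rightarrow> (complex^'n^'n) set"
  assumes "group G"
    and "\<exists>S. finite S \<and> S \<subseteq> carrier G \<and> generate G S = carrier G"
    and "A \<lhd> G"
    and "finite (rcosets\<^bsub>G\<^esub> A)"
    and "\<psi> \<in> hom (G Mod A) proj_unitary_group"
  defines "E \<equiv> Hom_A_psi G A \<psi>"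
    and "X \<equiv> char_group G A"
    and "R \<equiv> (\<lambda>\<rho> \<in> Hom_A_psi G A \<psi>. restrict \<rho> A)"
  shows "finite (carrier X) \<and> group X
     \<and> group_action X E (char_action G A E)
     \<and> (\<forall>c \<in> carrier X. \<forall>\<rho> \<in> E. char_action G A E c \<rho> = \<rho> \<longrightarrow> c = \<one>\<^bsub>X\<^esub>)
     \<and> R ` E \<subseteq> Hom_circle G A
     \<and> (\<exists>f. homeomorphic_map
              (partition_quotient_top (subtopology (pointwise_top (carrier G)) E)
                 (orbits X E (char_action G A E)))
              (subtopology (pointwise_top A) (R ` E)) f
            \<and> (\<forall>\<rho> \<in> E. f (orbit X (char_action G A E) \<rho>) = R \<rho>))
     \<and> covering_map (subtopology (pointwise_top (carrier G)) E)
                     (subtopology (pointwise_top A) (R ` E)) R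
     \<and> (\<forall>\<rho> \<in> E. {\<rho>' \<in> E. R \<rho>' = R \<rho>} = orbit X (char_action G A E) \<rho>)"
proof -
  interpret L: projective_lifts G A \<psi>
    using assms(1,3,4,5) by (rule projective_lifts.intro)
  interpret P: orbit_projection "L.X" "L.lifts_top" "L.act" "L.restrictions_top" "L.R"
    by (rule L.restriction_orbit_projection)
  have covering: "covering_map L.lifts_top L.restrictions_top L.R"
  proof (rule P.covering_map_of_free_action)
    show "finite (carrier L.X)" by (rule L.char_group_finite)
    show "Hausdorff_space L.lifts_top"
      by (intro Hausdorff_space_subtopology Hausdorff_pointwise_top)
    show "\<forall>c\<in>carrier L.X. \<forall>\<rho>\<in>topspace L.lifts_top. L.act c \<rho> = \<rho> \<longrightarrow> c = \<one>\<^bsub>L.X\<^esub>"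
      unfolding L.topspace_lifts_top using L.char_action_free by blast
  qed
  have orbit_space: "homeomorphic_map (partition_quotient_top L.lifts_top (orbits L.X L.E L.act))
      L.restrictions_top (fibre_value L.R)"
    using P.orbit_space_homeomorphic unfolding L.topspace_lifts_top .
  have orbit_value: "\<forall>\<rho>\<in>L.E. fibre_value L.R (orbit L.X L.act \<rho>) = L.R \<rho>"
    using P.fibre_value_orbit unfolding L.topspace_lifts_top by blast
  show ?thesis
    unfolding E_def X_def R_def
    using L.char_group_finite L.char_group_group L.char_action_group_action L.char_action_free
      L.restriction_image orbit_space orbit_value covering L.restriction_fibre_eq_orbit
    by blast
qed

end
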